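(* For every $\delta>0$ there are infinitely many $n\in\mathbb N$ for which there exists a set $L$ of $n$ lines in $\mathbb R^2$ such that $L$ is $4$-independent, but for every subset $L'\subseteq L$ with $|L'|\ge n^{\frac45+\delta}$ there exist three (distinct) elements of $L'$ with a common point of intersection.
   Context: Given a family of sets $\mathcal F$ and a positive integer $k$, $\mathcal F$ is called $k$-independent if for every subset $\{F_1,\dots,F_k\}\subseteq\mathcal F$ of cardinality $k$ one has $F_1\cap\dots\cap F_k=\emptyset$. (So a set of lines is $4$-independent if no four distinct lines of it pass through a common point.) *)

theory Defs
  imports "HOL-Analysis.Analysis"
begin

(* Only meant for k > 0: then card S = k forces S to be a finite set of k distinct members of F. *)
definition k_independent :: "nat \<Rightarrow> 'a set set \<Rightarrow> bool" where
  "k_independent k F \<longleftrightarrow> (\<forall>S. S \<subseteq> F \<and> card S = k \<longrightarrow> \<Inter>S = {})"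

definition is_line :: "(real ^ 2) set \<Rightarrow> bool" where
  "is_line l \<longleftrightarrow> affine l \<and> aff_dim l = 1"

end

theory Submission
  imports Defs "HOL-Real_Asymp.Real_Asymp"
begin

text \<open>
The lines are taken from a grid \<open>y = a x + b\<close> with \<open>A\<close> integer slopes \<open>a\<close> and \<open>B = A ^ 7\<close> integer
intercepts \<open>b\<close>, which makes \<open>A ^ 8\<close> lines. Call a set of lines independent if no three of its members are
concurrent. The set \<open>L\<close> is a random subset of the grid from which one line of every concurrent quadruple
has been deleted, and the task is to show that every independent subset of \<open>L\<close> is small.

The grid satisfies a strong form of supersaturation (\<open>concurrent3_supersaturated\<close>): the lines have many
incidences with an integer grid of points, and by convexity every set of at least \<open>C * A ^ 7\<close> lines has as
many concurrent triples as one expects of a random set of that size. The threshold is of the right order,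
because a parallel class, with \<open>A ^ 7\<close> lines, is independent.

By the method of hypergraph containers (\<open>container_step\<close>, \<open>line_containers\<close>) every independent subset of the
grid therefore lies in one of at most \<open>exp (O (A ^ 4 * (1 + ln A) ^ 2))\<close> containers of at most \<open>64 * A ^ 7\<close> lines.

On the other hand there are only about \<open>A ^ 3 * B ^ 2 = A ^ 17\<close> concurrent quadruples, up to logarithms
(\<open>card_concurrent4_le\<close>), counting all points of concurrency and not only integer ones. Keeping each line with
probability about \<open>A ^ -3\<close>, up to logarithms, leaves about \<open>n = A ^ 5\<close> lines and fewer quadruples than lines,
so that deletion is harmless (\<open>sparse_sample\<close>). A container keeps about \<open>A ^ 4\<close> lines, and since the number of
containers is so small, with positive probability no container keeps more than \<open>O (A ^ 4 * (1 + ln A) ^ 2)\<close> lines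
(\<open>exists_line_set\<close>). This is \<open>n powr (4 / 5)\<close> up to logarithms. The exponent \<open>7\<close> in \<open>B = A ^ 7\<close> is the
choice for which the two obstacles coincide: the share \<open>n / A\<close> of a single parallel class in the sample, and
the size \<open>A ^ 4\<close> of the fingerprints that describe the containers.
\<close>

section \<open>Containers for 3-graphs with small codegree\<close>

text \<open>The families \<open>F\<close> below are families of independent sets, and the sets in \<open>\<C>\<close> are their containers.
All that matters about a container is that it is small and that there are few of them.\<close>

definition container_cover :: "'a set \<Rightarrow> real \<Rightarrow> nat \<Rightarrow> 'a set set \<Rightarrow> bool" where
  "container_cover V m K F \<longleftrightarrow>
     (\<exists>\<C>. finite \<C> \<and> card \<C> \<le> K \<and> (\<forall>C\<in>\<C>. C \<subseteq> V \<and> real (card C) \<le> m) \<and>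
        (\<forall>I\<in>F. \<exists>C\<in>\<C>. I \<subseteq> C))"

lemma container_coverE:
  assumes "container_cover V m K F"
  obtains \<C> where "finite \<C>" "card \<C> \<le> K"
    "\<forall>C\<in>\<C>. C \<subseteq> V \<and> real (card C) \<le> m" "\<forall>I\<in>F. \<exists>C\<in>\<C>. I \<subseteq> C"
  using assms unfolding container_cover_def by (elim exE conjE)

lemma container_cover_mono_vertices:
  assumes "container_cover V m K F" "V \<subseteq> V'"
  shows "container_cover V' m K F"
proof -
  obtain \<C> where c: "finite \<C>" "card \<C> \<le> K"
    "\<forall>C\<in>\<C>. C \<subseteq> V \<and> real (card C) \<le> m" "\<forall>I\<in>F. \<exists>C\<in>\<C>. I \<subseteq> C"
    using assms(1) by (rule container_coverE)
  have "\<forall>C\<in>\<C>. C \<subseteq> V' \<and> real (card C) \<le> m" using c(3) assms(2) by blast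
  with c(1,2,4) show ?thesis unfolding container_cover_def by (intro exI conjI)
qed

lemma container_cover_mono:
  assumes "container_cover V m K F" "F' \<subseteq> F" "K \<le> K'"
  shows "container_cover V m K' F'"
proof -
  obtain \<C> where c: "finite \<C>" "card \<C> \<le> K"
    "\<forall>C\<in>\<C>. C \<subseteq> V \<and> real (card C) \<le> m" "\<forall>I\<in>F. \<exists>C\<in>\<C>. I \<subseteq> C"
    using assms(1) by (rule container_coverE)
  have "card \<C> \<le> K'" "\<forall>I\<in>F'. \<exists>C\<in>\<C>. I \<subseteq> C" using c(2,4) assms(2,3) by auto
  with c(1,3) show ?thesis unfolding container_cover_def by (intro exI conjI)
qed

lemma container_cover_single:
  assumes "C \<subseteq> V" "real (card C) \<le> m" "\<And>I. I \<in> F \<Longrightarrow> I \<subseteq> C"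
  shows "container_cover V m 1 F"
  unfolding container_cover_def using assms by (intro exI[of _ "{C}"]) auto

lemma container_cover_Un:
  assumes "container_cover V m K F" "container_cover V m K' F'"
  shows "container_cover V m (K + K') (F \<union> F')"
proof -
  obtain \<C> where c: "finite \<C>" "card \<C> \<le> K" "\<forall>C\<in>\<C>. C \<subseteq> V \<and> real (card C) \<le> m"
      "\<forall>I\<in>F. \<exists>C\<in>\<C>. I \<subseteq> C"
    using assms(1) by (rule container_coverE)
  obtain \<D> where d: "finite \<D>" "card \<D> \<le> K'" "\<forall>C\<in>\<D>. C \<subseteq> V \<and> real (card C) \<le> m"
      "\<forall>I\<in>F'. \<exists>C\<in>\<D>. I \<subseteq> C"
    using assms(2) by (rule container_coverE)
  have "card (\<C> \<union> \<D>) \<le> K + K'"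
    using card_Un_le[of \<C> \<D>] c(2) d(2) by linarith
  moreover have "\<forall>C\<in>\<C> \<union> \<D>. C \<subseteq> V \<and> real (card C) \<le> m"
    using c(3) d(3) by (simp add: ball_Un)
  moreover have "\<forall>I\<in>F \<union> F'. \<exists>C\<in>\<C> \<union> \<D>. I \<subseteq> C"
    using c(4) d(4) by (simp add: ball_Un bex_Un)
  moreover have "finite (\<C> \<union> \<D>)" using c(1) d(1) by simp
  ultimately show ?thesis unfolding container_cover_def by (intro exI conjI)
qed

lemma container_cover_UN:
  assumes "finite S" "\<And>x. x \<in> S \<Longrightarrow> container_cover V m K (F x)"
  shows "container_cover V m (card S * K) (\<Union>x\<in>S. F x)"
  using assms
proof (induction S rule: finite_induct)
  case empty
  show ?case unfolding container_cover_def by (auto intro: exI[of _ "{}"])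
next
  case (insert x S)
  then have "container_cover V m (K + card S * K) (F x \<union> (\<Union>x\<in>S. F x))"
    by (intro container_cover_Un) auto
  moreover have "card (insert x S) * K = K + card S * K"
    using insert.hyps by simp
  ultimately show ?case by (simp only: UN_insert)
qed

text \<open>This is the counting behind every fingerprint argument. An independent set \<open>I\<close> carries along a state \<open>s\<close>
that records what is known about it. As long as \<open>I\<close> has a vertex \<open>v\<close> that would improve the state by at
least \<open>d\<close>, one branches over the possible \<open>v\<close>; since the potential \<open>\<Phi>\<close> is bounded, a branch has at
most \<open>j\<close> such steps, which gives the factor \<open>(card V + 1) ^ j\<close>. At the end of a branch no vertex of \<open>I\<close>
is an improvement, and this negative information is what confines \<open>I\<close> to a container.\<close>

lemma container_cover_branching:
  fixes gain :: "'a \<Rightarrow> 's \<Rightarrow> real" and \<Phi> :: "'s \<Rightarrow> real"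
  assumes fin: "finite V"
    and leaf: "\<And>s. S s \<Longrightarrow> container_cover V m K {I \<in> F s. \<forall>v\<in>I. gain v s < d}"
    and inherit: "\<And>s v I. S s \<Longrightarrow> I \<in> F s \<Longrightarrow> v \<in> I \<Longrightarrow> v \<in> V \<and> I \<in> F (upd v s)"
    and step: "\<And>s v. S s \<Longrightarrow> v \<in> V \<Longrightarrow> d \<le> gain v s \<Longrightarrow> S (upd v s) \<and> \<Phi> s + d \<le> \<Phi> (upd v s)"
    and bound: "\<And>s. S s \<Longrightarrow> \<Phi> s \<le> b"
  shows "S s \<Longrightarrow> b < \<Phi> s + real j * d \<Longrightarrow> container_cover V m ((card V + 1) ^ j * K) (F s)"
proof (induction j arbitrary: s)
  case 0
  then show ?case using bound[of s] by simp
next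
  case (Suc j)
  let ?W = "{v \<in> V. d \<le> gain v s}"
  let ?K = "(card V + 1) ^ j * K"
  have "container_cover V m ?K (F (upd v s))" if "v \<in> ?W" for v
    using step[of s v] Suc that by (intro Suc.IH) (auto simp: algebra_simps)
  then have W: "container_cover V m (card ?W * ?K) (\<Union>v\<in>?W. F (upd v s))"
    using fin by (intro container_cover_UN) auto
  have eq: "F s \<subseteq> {I \<in> F s. \<forall>v\<in>I. gain v s < d} \<union> (\<Union>v\<in>?W. F (upd v s))"
  proof
    fix I assume I: "I \<in> F s"
    show "I \<in> {I \<in> F s. \<forall>v\<in>I. gain v s < d} \<union> (\<Union>v\<in>?W. F (upd v s))"
    proof (cases "\<forall>v\<in>I. gain v s < d")
      case False
      then obtain v where v: "v \<in> I" "d \<le> gain v s" by (auto simp: not_less)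
      with inherit[OF Suc.prems(1) I v(1)] show ?thesis by blast
    qed (use I in auto)
  qed
  have "card ?W \<le> card V" using fin by (intro card_mono) auto
  then have "card ?W * ?K \<le> card V * ?K" by (rule mult_le_mono1)
  moreover have "K \<le> ?K" by simp
  ultimately have "K + card ?W * ?K \<le> ?K + card V * ?K" by linarith
  also have "\<dots> = (card V + 1) ^ Suc j * K" by (simp add: algebra_simps)
  finally show ?case
    using container_cover_mono[OF container_cover_Un[OF leaf[OF Suc.prems(1)] W] eq] by blast
qed

definition nbrs :: "('a \<times> 'a) set \<Rightarrow> 'a \<Rightarrow> 'a set" where
  "nbrs G v = {w. (v, w) \<in> G}"

definition indep2 :: "('a \<times> 'a) set \<Rightarrow> 'a set \<Rightarrow> bool" where
  "indep2 G I \<longleftrightarrow> (\<forall>u\<in>I. \<forall>w\<in>I. (u, w) \<notin> G)"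

definition indep3 :: "('a \<Rightarrow> 'a \<Rightarrow> 'a \<Rightarrow> bool) \<Rightarrow> 'a set \<Rightarrow> bool" where
  "indep3 E I \<longleftrightarrow> (\<forall>u\<in>I. \<forall>v\<in>I. \<forall>w\<in>I. \<not> E u v w)"

text \<open>If \<open>v\<close> lies in an independent set \<open>I\<close> of a 3-graph, then no edge of the link of \<open>v\<close> lies in \<open>I\<close>.
The pairs of that link are collected in a graph \<open>G\<close>, but only as long as both ends still have degree
below \<open>cap\<close>: this keeps the degrees of \<open>G\<close> within a constant factor of \<open>cap\<close>, without which a few hubs
could absorb all edges and \<open>G\<close> would exclude almost nothing. Graphs are symmetric sets of ordered pairs.\<close>

definition new_pairs :: "'a set \<Rightarrow> ('a \<Rightarrow> 'a \<Rightarrow> 'a \<Rightarrow> bool) \<Rightarrow> real \<Rightarrow> 'a \<Rightarrow> ('a \<times> 'a) set \<Rightarrow> ('a \<times> 'a) set" where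
  "new_pairs V E cap v G = {(u, w). u \<in> V \<and> w \<in> V \<and> E v u w \<and> (u, w) \<notin> G \<and>
     real (card (nbrs G u)) < cap \<and> real (card (nbrs G w)) < cap}"

lemma card_pairs_le:
  fixes c :: real
  assumes "finite A" "P \<subseteq> A \<times> B" "\<And>a. a \<in> A \<Longrightarrow> finite {b. (a, b) \<in> P}" "\<And>a. a \<in> A \<Longrightarrow> real (card {b. (a, b) \<in> P}) \<le> c"
  shows "real (card P) \<le> real (card A) * c"
proof -
  have "P = (SIGMA a:A. {b. (a, b) \<in> P})" using assms(2) by auto
  then have "card P = (\<Sum>a\<in>A. card {b. (a, b) \<in> P})"
    using card_SigmaI[OF assms(1), of "\<lambda>a. {b. (a, b) \<in> P}"] assms(3) by simp
  then have "real (card P) = (\<Sum>a\<in>A. real (card {b. (a, b) \<in> P}))" by simp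
  also have "\<dots> \<le> (\<Sum>a\<in>A. c)" by (intro sum_mono assms(4))
  finally show ?thesis by simp
qed

lemma card_pairs_ge:
  fixes c :: real
  assumes "finite A" "finite P" "\<And>a. a \<in> A \<Longrightarrow> c \<le> real (card {b. (a, b) \<in> P})"
  shows "real (card A) * c \<le> real (card P)"
proof -
  have f: "finite {b. (a, b) \<in> P}" for a
    by (rule finite_subset[of _ "snd ` P"]) (use assms(2) in force)+
  have "real (card A) * c = (\<Sum>a\<in>A. c)" by simp
  also have "\<dots> \<le> (\<Sum>a\<in>A. real (card {b. (a, b) \<in> P}))" by (intro sum_mono assms(3))
  also have "\<dots> = real (card (SIGMA a:A. {b. (a, b) \<in> P}))"
    by (subst card_SigmaI) (use assms(1) f in auto)
  also have "\<dots> \<le> real (card P)"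
    using assms(2) by (intro of_nat_mono card_mono) auto
  finally show ?thesis .
qed

text \<open>Here \<open>G\<close> is the graph of known forbidden pairs, \<open>X\<close> is a set of vertices known to lie outside \<open>I\<close>, and
\<open>C\<close> consists of the vertices that improve neither. Vertices of \<open>C\<close> of degree below \<open>cap\<close> span few
edges of the 3-graph: such an edge is either new for one of its vertices, and there are fewer than \<open>d\<close>
of those per vertex, or it contains a pair of \<open>G\<close>, and a vertex of \<open>C\<close> has fewer than \<open>\<delta>\<close> neighbours
in \<open>C\<close>, each pair lying in at most \<open>\<Delta>\<close> edges. So supersaturation leaves fewer than a quarter of all
vertices of this kind. Each of the other vertices of \<open>C\<close> sends at least \<open>cap / 2\<close> edges to \<open>X\<close>, and as
degrees are at most \<open>2 * cap\<close>, the set \<open>X\<close> is at least a quarter as large as the set of these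
vertices. As \<open>X\<close> and \<open>C\<close> are disjoint, \<open>C\<close> cannot contain almost all of \<open>V\<close>.\<close>

lemma container_size:
  fixes cap \<delta> d \<Delta> :: real
  assumes fin: "finite V" and ne: "V \<noteq> {}"
    and codeg: "\<And>u w. u \<in> V \<Longrightarrow> w \<in> V \<Longrightarrow> real (card {v \<in> V. E v u w}) \<le> \<Delta>"
    and cap: "0 < \<Delta>" "\<Delta> \<le> cap" and \<delta>: "\<delta> \<le> cap / 2"
    and supersat: "\<And>U. U \<subseteq> V \<Longrightarrow> real (card V) / 4 \<le> real (card U) \<Longrightarrow>
        (d + \<Delta> * \<delta>) * real (card U) \<le> real (card {(v, u, w). v \<in> U \<and> u \<in> U \<and> w \<in> U \<and> E v u w})"
    and G: "G \<subseteq> V \<times> V" "sym G" "\<And>u. u \<in> V \<Longrightarrow> real (card (nbrs G u)) \<le> cap + \<Delta>"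
    and X: "X \<subseteq> V"
    and C: "C = {v \<in> V - X. real (card (new_pairs V E cap v G)) < d \<and> real (card (nbrs G v - X)) < \<delta>}"
  shows "real (card C) \<le> 7 / 8 * real (card V)"
proof -
  have cappos: "cap > 0" using cap by linarith
  have finG: "finite G" using G(1) fin finite_subset by blast
  have nV: "nbrs G v \<subseteq> V" for v using G(1) by (auto simp: nbrs_def)
  have fn: "finite (nbrs G v)" for v using nV fin finite_subset by blast
  have finC: "finite C" and CV: "C \<subseteq> V" and CX: "C \<inter> X = {}" using C fin by auto
  have finX: "finite X" using X fin finite_subset by blast
  define U where "U = {v \<in> C. real (card (nbrs G v)) < cap}"
  define R where "R = {v \<in> C. cap \<le> real (card (nbrs G v))}"
  have UC: "U \<subseteq> C" and finU: "finite U" using finC by (auto simp: U_def)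
  have UV: "U \<subseteq> V" using UC CV by simp
  have CUR: "card C = card U + card R"
  proof -
    have "C = U \<union> R" "U \<inter> R = {}" by (auto simp: U_def R_def)
    then show ?thesis using finC by (metis card_Un_disjoint finite_Un)
  qed
  have Usmall: "real (card U) < real (card V) / 4"
  proof (rule ccontr)
    assume "\<not> ?thesis"
    then have Ubig: "real (card V) / 4 \<le> real (card U)" by simp
    moreover have "card V > 0" using fin ne by (simp add: card_gt_0_iff)
    ultimately have Upos: "card U > 0" by (cases "card U") auto
    define T where "T = {(v, u, w). v \<in> U \<and> u \<in> U \<and> w \<in> U \<and> E v u w}"
    define T1 where "T1 = {(v, p). v \<in> U \<and> p \<in> new_pairs V E cap v G}"
    define P where "P = {(u, w). u \<in> U \<and> w \<in> U \<and> (u, w) \<in> G}"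
    define T2 where "T2 = {(p, v). p \<in> P \<and> v \<in> V \<and> E v (fst p) (snd p)}"
    have finnew: "finite (new_pairs V E cap v G)" for v
      by (rule finite_subset[of _ "V \<times> V"]) (auto simp: new_pairs_def fin)
    have finT1: "finite T1"
      by (rule finite_subset[of _ "U \<times> (V \<times> V)"]) (auto simp: T1_def new_pairs_def fin finU)
    have finP: "finite P" by (rule finite_subset[OF _ finG]) (auto simp: P_def)
    have finT2: "finite T2"
      by (rule finite_subset[of _ "P \<times> V"]) (auto simp: T2_def fin finP)
    have "T \<subseteq> T1 \<union> (\<lambda>(p, v). (v, p)) ` T2"
    proof
      fix t assume "t \<in> T"
      then obtain v u w where t: "t = (v, u, w)" "v \<in> U" "u \<in> U" "w \<in> U" "E v u w"
        by (auto simp: T_def)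
      show "t \<in> T1 \<union> (\<lambda>(p, v). (v, p)) ` T2"
      proof (cases "(u, w) \<in> G")
        case True
        then have "((u, w), v) \<in> T2" using t UV by (auto simp: T2_def P_def)
        then show ?thesis using t(1) by force
      next
        case False
        then have "(v, (u, w)) \<in> T1"
          using t UV by (auto simp: T1_def new_pairs_def U_def)
        then show ?thesis using t(1) by simp
      qed
    qed
    then have "card T \<le> card (T1 \<union> (\<lambda>(p, v). (v, p)) ` T2)"
      using finT1 finT2 by (intro card_mono) auto
    also have "\<dots> \<le> card T1 + card T2"
      using card_Un_le[of T1 "(\<lambda>(p, v). (v, p)) ` T2"] card_image_le[OF finT2, of "\<lambda>(p, v). (v, p)"]
      by linarith
    finally have T12: "real (card T) \<le> real (card T1) + real (card T2)" by simp
    have T1b: "real (card T1) < real (card U) * d"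
    proof -
      have "T1 = (SIGMA v:U. new_pairs V E cap v G)" by (auto simp: T1_def)
      then have "real (card T1) = (\<Sum>v\<in>U. real (card (new_pairs V E cap v G)))"
        by (simp add: card_SigmaI[OF finU] finnew)
      also have "\<dots> < (\<Sum>v\<in>U. d)"
        using UC Upos by (intro sum_strict_mono finU) (auto simp: C)
      finally show ?thesis by simp
    qed
    have Pb: "real (card P) \<le> real (card U) * \<delta>"
    proof (rule card_pairs_le[OF finU])
      show "P \<subseteq> U \<times> U" by (auto simp: P_def)
      fix a assume a: "a \<in> U"
      show "finite {b. (a, b) \<in> P}"
        by (rule finite_subset[OF _ finU]) (auto simp: P_def)
      have "{b. (a, b) \<in> P} \<subseteq> nbrs G a - X" using UC CX by (auto simp: P_def nbrs_def)
      then have "card {b. (a, b) \<in> P} \<le> card (nbrs G a - X)" using fn by (intro card_mono) auto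
      moreover have "real (card (nbrs G a - X)) < \<delta>" using a UC C by auto
      ultimately show "real (card {b. (a, b) \<in> P}) \<le> \<delta>" by linarith
    qed
    have "real (card T2) \<le> real (card P) * \<Delta>"
    proof (rule card_pairs_le[OF finP])
      show "T2 \<subseteq> P \<times> V" by (auto simp: T2_def)
      fix p assume p: "p \<in> P"
      show "finite {b. (p, b) \<in> T2}"
        by (rule finite_subset[OF _ fin]) (auto simp: T2_def)
      have pV: "fst p \<in> V" "snd p \<in> V" using p UV by (auto simp: P_def)
      have "{b. (p, b) \<in> T2} = {v \<in> V. E v (fst p) (snd p)}" using p by (auto simp: T2_def)
      then show "real (card {b. (p, b) \<in> T2}) \<le> \<Delta>"
        using codeg[of "fst p" "snd p"] pV by simp
    qed
    also have "\<dots> \<le> (real (card U) * \<delta>) * \<Delta>"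
      using Pb cap by (intro mult_right_mono) auto
    finally have "real (card T) < (d + \<Delta> * \<delta>) * real (card U)"
      using T12 T1b by (simp add: algebra_simps)
    then show False using supersat[OF UV Ubig] by (simp add: T_def)
  qed
  have "real (card R) / 4 \<le> real (card X)"
  proof -
    define P where "P = {(x, v). x \<in> X \<and> v \<in> R \<and> (x, v) \<in> G}"
    have finR: "finite R" using finC by (auto simp: R_def)
    have finP: "finite P" by (rule finite_subset[OF _ finG]) (auto simp: P_def)
    have "real (card P) \<le> real (card X) * (cap + \<Delta>)"
    proof (rule card_pairs_le[OF finX])
      show "P \<subseteq> X \<times> R" by (auto simp: P_def)
      fix a assume a: "a \<in> X"
      show "finite {b. (a, b) \<in> P}"
        by (rule finite_subset[OF _ finR]) (auto simp: P_def)
      have "card {b. (a, b) \<in> P} \<le> card (nbrs G a)"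
        using fn by (intro card_mono) (auto simp: P_def nbrs_def)
      then show "real (card {b. (a, b) \<in> P}) \<le> cap + \<Delta>" using G(3)[of a] a X by auto
    qed
    moreover have "real (card R) * (cap / 2) \<le> real (card (P\<inverse>))"
    proof (rule card_pairs_ge[OF finR])
      show "finite (P\<inverse>)" using finP by simp
      fix v assume v: "v \<in> R"
      have "{x. (v, x) \<in> P\<inverse>} = nbrs G v \<inter> X"
        using v G(2) by (auto simp: P_def nbrs_def sym_def)
      moreover have "card (nbrs G v) = card (nbrs G v \<inter> X) + card (nbrs G v - X)"
        using fn[of v] by (metis card_Int_Diff)
      moreover have "real (card (nbrs G v - X)) < \<delta>" "cap \<le> real (card (nbrs G v))"
        using v C by (auto simp: R_def)
      ultimately show "cap / 2 \<le> real (card {x. (v, x) \<in> P\<inverse>})" using \<delta> by simp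
    qed
    ultimately have "real (card R) * (cap / 2) \<le> real (card X) * (cap + \<Delta>)" by simp
    also have "\<dots> \<le> real (card X) * (2 * cap)" using cap by (intro mult_left_mono) auto
    finally show ?thesis using cappos by (simp add: field_simps)
  qed
  moreover have "real (card C) + real (card X) \<le> real (card V)"
  proof -
    have "card C + card X = card (C \<union> X)" using CX finC finX by (simp add: card_Un_disjoint)
    also have "\<dots> \<le> card V" using CV X fin by (intro card_mono) auto
    finally show ?thesis by linarith
  qed
  ultimately show ?thesis using Usmall CUR by linarith
qed

text \<open>Two rounds of branching. The first one enlarges \<open>G\<close>, which has at most \<open>card V * (cap + \<Delta>)\<close> ordered
pairs, by at least \<open>d\<close> pairs per step; the second one fixes \<open>G\<close> and enlarges the set \<open>X\<close> of excluded
vertices by at least \<open>\<delta>\<close> per step.\<close>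

lemma container_step:
  fixes cap \<delta> d \<Delta> :: real
  assumes fin: "finite V" and ne: "V \<noteq> {}"
    and symE: "\<And>u v w. E v u w \<Longrightarrow> E v w u" "\<And>u v w. E v u w \<Longrightarrow> E u v w"
    and codeg: "\<And>u w. u \<in> V \<Longrightarrow> w \<in> V \<Longrightarrow> real (card {v \<in> V. E v u w}) \<le> \<Delta>"
    and cap: "0 < \<Delta>" "\<Delta> \<le> cap" and \<delta>: "\<delta> \<le> cap / 2"
    and supersat: "\<And>U. U \<subseteq> V \<Longrightarrow> real (card V) / 4 \<le> real (card U) \<Longrightarrow>
        (d + \<Delta> * \<delta>) * real (card U) \<le> real (card {(v, u, w). v \<in> U \<and> u \<in> U \<and> w \<in> U \<and> E v u w})"
    and j: "real (card V) * (cap + \<Delta>) < real j * d" and l: "real (card V) < real l * \<delta>"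
  shows "container_cover V (7 / 8 * real (card V)) ((card V + 1) ^ (j + l)) {I. I \<subseteq> V \<and> indep3 E I}"
proof -
  define S where "S G \<longleftrightarrow> G \<subseteq> V \<times> V \<and> sym G \<and> (\<forall>u\<in>V. real (card (nbrs G u)) \<le> cap + \<Delta>)" for G
  let ?m = "7 / 8 * real (card V)"
  let ?new = "new_pairs V E cap"
  have nV: "nbrs G v \<subseteq> V" if "S G" for G v using that by (auto simp: nbrs_def S_def)
  have graph: "container_cover V ?m ((card V + 1) ^ l)
      {I \<in> {I. I \<subseteq> V \<and> indep3 E I \<and> indep2 G I}. \<forall>v\<in>I. real (card (?new v G)) < d}" if G: "S G" for G
  proof -
    define F where "F X = {I. I \<subseteq> V - X \<and> indep2 G I \<and> (\<forall>v\<in>I. real (card (?new v G)) < d)}" for X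
    have "container_cover V ?m ((card V + 1) ^ l * 1) (F {})"
    proof (rule container_cover_branching[where S = "\<lambda>X. X \<subseteq> V" and F = F and s = "{}" and d = \<delta> and
          gain = "\<lambda>v X. real (card (nbrs G v - X))" and \<Phi> = "\<lambda>X. real (card X)" and
          b = "real (card V)" and upd = "\<lambda>v X. X \<union> nbrs G v"])
      fix X assume X: "X \<subseteq> V"
      let ?C = "{v \<in> V - X. real (card (?new v G)) < d \<and> real (card (nbrs G v - X)) < \<delta>}"
      show "container_cover V ?m 1 {I \<in> F X. \<forall>v\<in>I. real (card (nbrs G v - X)) < \<delta>}"
      proof (rule container_cover_single)
        show "real (card ?C) \<le> ?m"
        proof (rule container_size[OF fin ne codeg cap \<delta> supersat _ _ _ X refl])
          show "G \<subseteq> V \<times> V" "sym G" using G by (simp_all add: S_def)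
          show "real (card (nbrs G u)) \<le> cap + \<Delta>" if "u \<in> V" for u using G that by (simp add: S_def)
        qed
      qed (auto simp: F_def)
    next
      fix X v I assume "X \<subseteq> V" "I \<in> F X" "v \<in> I"
      then show "v \<in> V \<and> I \<in> F (X \<union> nbrs G v)"
        by (auto simp: F_def indep2_def nbrs_def)
    next
      fix X v assume X: "X \<subseteq> V" "v \<in> V" "\<delta> \<le> real (card (nbrs G v - X))"
      have "card (X \<union> nbrs G v) = card X + card (nbrs G v - X)"
        using card_Un_disjoint[of X "nbrs G v - X"] finite_subset[OF X(1) fin]
          finite_subset[OF nV[OF G] fin] by auto
      then show "X \<union> nbrs G v \<subseteq> V \<and> real (card X) + \<delta> \<le> real (card (X \<union> nbrs G v))"
        using X nV[OF G] by auto
    next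
      fix X assume "X \<subseteq> V"
      then show "real (card X) \<le> real (card V)" using fin by (simp add: card_mono)
    qed (use fin l in auto)
    then show ?thesis
      by (rule container_cover_mono) (auto simp: F_def)
  qed
  have "container_cover V ?m ((card V + 1) ^ j * (card V + 1) ^ l) {I. I \<subseteq> V \<and> indep3 E I \<and> indep2 {} I}"
  proof (rule container_cover_branching[where S = S and d = d and
        gain = "\<lambda>v G. real (card (?new v G))" and \<Phi> = "\<lambda>G. real (card G)" and
        F = "\<lambda>G. {I. I \<subseteq> V \<and> indep3 E I \<and> indep2 G I}" and
        b = "real (card V) * (cap + \<Delta>)" and upd = "\<lambda>v G. G \<union> ?new v G"])
    fix G assume "S G"
    then show "container_cover V ?m ((card V + 1) ^ l)
      {I \<in> {I. I \<subseteq> V \<and> indep3 E I \<and> indep2 G I}. \<forall>v\<in>I. real (card (?new v G)) < d}"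
      by (rule graph)
  next
    fix G v I assume "S G" "I \<in> {I. I \<subseteq> V \<and> indep3 E I \<and> indep2 G I}" "v \<in> I"
    then show "v \<in> V \<and> I \<in> {I. I \<subseteq> V \<and> indep3 E I \<and> indep2 (G \<union> ?new v G) I}"
      by (auto simp: indep2_def indep3_def new_pairs_def)
  next
    fix G v assume G: "S G" and v: "v \<in> V" and gain: "d \<le> real (card (?new v G))"
    let ?G = "G \<union> ?new v G"
    have nw: "?new v G \<subseteq> V \<times> V" by (auto simp: new_pairs_def)
    have finVV: "finite (V \<times> V)" using fin by simp
    have GV: "G \<subseteq> V \<times> V" and symG: "sym G" and degG: "\<forall>u\<in>V. real (card (nbrs G u)) \<le> cap + \<Delta>"
      using G unfolding S_def by blast+
    note fG = finite_subset[OF GV finVV] finite_subset[OF nw finVV]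
    have "sym (?new v G)"
    proof (rule symI)
      fix u w assume uw: "(u, w) \<in> ?new v G"
      then have "E v w u" using symE(1)[of v u w] by (simp add: new_pairs_def)
      moreover have "(w, u) \<notin> G" using uw symD[OF symG, of w u] by (auto simp: new_pairs_def)
      ultimately show "(w, u) \<in> ?new v G" using uw by (simp add: new_pairs_def)
    qed
    then have sy: "sym ?G" using symG by (simp add: sym_Un)
    have deg: "real (card (nbrs ?G u)) \<le> cap + \<Delta>" if u: "u \<in> V" for u
    proof (cases "real (card (nbrs G u)) < cap")
      case False
      then have "nbrs ?G u = nbrs G u" by (auto simp: nbrs_def new_pairs_def)
      then show ?thesis using degG u by simp
    next
      case True
      have "nbrs ?G u \<subseteq> nbrs G u \<union> {w \<in> V. E w v u}"
      proof
        fix w assume w: "w \<in> nbrs ?G u"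
        show "w \<in> nbrs G u \<union> {w \<in> V. E w v u}"
        proof (cases "(u, w) \<in> G")
          case False
          then have "E v u w" "w \<in> V" using w by (auto simp: nbrs_def new_pairs_def)
          then show ?thesis using symE(2)[OF symE(1)] by simp
        qed (simp add: nbrs_def)
      qed
      moreover have "finite (nbrs G u)" using nV[OF G] fin finite_subset by blast
      ultimately have "card (nbrs ?G u) \<le> card (nbrs G u \<union> {w \<in> V. E w v u})"
        using fin by (intro card_mono) auto
      also have "\<dots> \<le> card (nbrs G u) + card {w \<in> V. E w v u}" by (rule card_Un_le)
      finally show ?thesis using True codeg[OF v u] by linarith
    qed
    have "card ?G = card G + card (?new v G)"
      using fG by (intro card_Un_disjoint) (auto simp: new_pairs_def)
    then show "S ?G \<and> real (card G) + d \<le> real (card ?G)"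
      using GV sy deg gain nw by (simp add: S_def)
  next
    fix G assume G: "S G"
    have "finite (nbrs G a)" for a using nV[OF G] fin finite_subset by blast
    then show "real (card G) \<le> real (card V) * (cap + \<Delta>)"
      using G by (intro card_pairs_le[OF fin, of _ V]) (auto simp: S_def nbrs_def)
  qed (use fin j cap in \<open>simp_all add: S_def sym_def nbrs_def\<close>)
  then show ?thesis
    by (rule container_cover_mono) (auto simp: indep2_def power_add)
qed

text \<open>Repeating a step that shrinks every large set by the factor \<open>q\<close> brings all containers down to size \<open>M\<close>.\<close>

lemma container_cover_iterate:
  fixes M q :: real
  assumes q: "0 < q"
    and step: "\<And>V. V \<subseteq> \<Omega> \<Longrightarrow> M < real (card V) \<Longrightarrow>
        container_cover V (q * real (card V)) K {I \<in> F. I \<subseteq> V}"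
    and K: "K \<ge> 1"
  shows "V \<subseteq> \<Omega> \<Longrightarrow> q ^ j * real (card V) \<le> M \<Longrightarrow> container_cover V M (K ^ j) {I \<in> F. I \<subseteq> V}"
proof (induction j arbitrary: V)
  case 0
  then have "container_cover V M 1 {I \<in> F. I \<subseteq> V}" by (intro container_cover_single[of V]) auto
  then show ?case by simp
next
  case (Suc j)
  show ?case
  proof (cases "real (card V) \<le> M")
    case True
    then have "container_cover V M 1 {I \<in> F. I \<subseteq> V}" by (intro container_cover_single[of V]) auto
    then show ?thesis by (rule container_cover_mono) (use K in auto)
  next
    case False
    then have "container_cover V (q * real (card V)) K {I \<in> F. I \<subseteq> V}"
      using Suc.prems(1) by (intro step) auto
    then obtain \<C> where c: "finite \<C>" "card \<C> \<le> K"
      "\<forall>C\<in>\<C>. C \<subseteq> V \<and> real (card C) \<le> q * real (card V)"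
      "\<forall>I\<in>{I \<in> F. I \<subseteq> V}. \<exists>C\<in>\<C>. I \<subseteq> C"
      by (rule container_coverE)
    note c3 = bspec[OF c(3)]
    have "container_cover V M (K ^ j) {I \<in> F. I \<subseteq> C}" if "C \<in> \<C>" for C
    proof -
      have "q ^ j * real (card C) \<le> q ^ j * (q * real (card V))"
        using c3[OF that] q by (intro mult_left_mono) auto
      also have "\<dots> \<le> M" using Suc.prems(2) by (simp add: algebra_simps)
      finally have "container_cover C M (K ^ j) {I \<in> F. I \<subseteq> C}"
        using c3[OF that] Suc.prems(1) by (intro Suc.IH) auto
      then show ?thesis
        by (rule container_cover_mono_vertices) (use c3[OF that] in simp)
    qed
    then have "container_cover V M (card \<C> * K ^ j) (\<Union>C\<in>\<C>. {I \<in> F. I \<subseteq> C})"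
      by (rule container_cover_UN[OF c(1)])
    then show ?thesis
    proof (rule container_cover_mono)
      show "{I \<in> F. I \<subseteq> V} \<subseteq> (\<Union>C\<in>\<C>. {I \<in> F. I \<subseteq> C})" using c(4) by blast
      show "card \<C> * K ^ j \<le> K ^ Suc j" using c(2) by simp
    qed
  qed
qed

section \<open>Concurrent triples in a grid of lines\<close>

text \<open>The pair \<open>(a, b)\<close> stands for the line of slope \<open>a\<close> and intercept \<open>b\<close>.\<close>

definition on_line :: "real \<times> real \<Rightarrow> int \<times> int \<Rightarrow> bool" where
  "on_line p l \<longleftrightarrow> snd p = of_int (fst l) * fst p + of_int (snd l)"

definition concurrent :: "(int \<times> int) set \<Rightarrow> bool" where
  "concurrent S \<longleftrightarrow> (\<exists>p. \<forall>l\<in>S. on_line p l)"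

definition concurrent3 :: "int \<times> int \<Rightarrow> int \<times> int \<Rightarrow> int \<times> int \<Rightarrow> bool" where
  "concurrent3 u v w \<longleftrightarrow> u \<noteq> v \<and> u \<noteq> w \<and> v \<noteq> w \<and> concurrent {u, v, w}"

definition grid_lines :: "nat \<Rightarrow> nat \<Rightarrow> (int \<times> int) set" where
  "grid_lines A B = {0..<int A} \<times> {0..<int B}"

lemma finite_grid_lines [simp]: "finite (grid_lines A B)"
  and card_grid_lines [simp]: "card (grid_lines A B) = A * B"
  by (simp_all add: grid_lines_def)

lemma on_line_same_slope:
  assumes "on_line p l" "on_line p l'" "fst l = fst l'"
  shows "l = l'"
  using assms by (auto simp: on_line_def prod_eq_iff)

lemma on_line_unique_point:
  assumes "on_line p l" "on_line p l'" "on_line q l" "on_line q l'" "l \<noteq> l'"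
  shows "p = q"
proof -
  have sl: "fst l \<noteq> fst l'" using on_line_same_slope assms by blast
  have "(of_int (fst l) - of_int (fst l')) * (fst p - fst q) = 0"
    using assms unfolding on_line_def by (simp add: algebra_simps)
  then have "fst p = fst q" using sl by simp
  then show ?thesis using assms unfolding on_line_def by (simp add: prod_eq_iff)
qed

text \<open>Two lines meet in at most one point, and a third line through that point is determined by its slope.\<close>

lemma card_concurrent3_le:
  assumes "V \<subseteq> grid_lines A B"
  shows "card {v \<in> V. concurrent3 v u w} \<le> A"
proof -
  have "inj_on fst {v \<in> V. concurrent3 v u w}"
  proof (rule inj_onI)
    fix v v' assume v: "v \<in> {v \<in> V. concurrent3 v u w}" "v' \<in> {v \<in> V. concurrent3 v u w}" "fst v = fst v'"
    obtain p where p: "on_line p v" "on_line p u" "on_line p w" "u \<noteq> w"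
      using v(1) by (auto simp: concurrent3_def concurrent_def)
    obtain q where q: "on_line q v'" "on_line q u" "on_line q w"
      using v(2) by (auto simp: concurrent3_def concurrent_def)
    have "p = q" using on_line_unique_point p q by blast
    then show "v = v'" using on_line_same_slope p(1) q(1) v(3) by blast
  qed
  then have "card {v \<in> V. concurrent3 v u w} \<le> card {0..<int A}"
    by (rule card_inj_on_le) (use assms in \<open>auto simp: grid_lines_def\<close>)
  then show ?thesis by simp
qed

lemma card_distinct_triples:
  assumes "finite R"
  shows "card {(u, v, w). u \<in> R \<and> v \<in> R \<and> w \<in> R \<and> u \<noteq> v \<and> u \<noteq> w \<and> v \<noteq> w}
    = card R * ((card R - 1) * (card R - 2))"
proof -
  have "{(u, v, w). u \<in> R \<and> v \<in> R \<and> w \<in> R \<and> u \<noteq> v \<and> u \<noteq> w \<and> v \<noteq> w}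
    = (SIGMA u:R. SIGMA v:R - {u}. R - {u, v})" by auto
  also have "card \<dots> = (\<Sum>u\<in>R. \<Sum>v\<in>R - {u}. card (R - {u, v}))"
    using assms by (simp add: card_SigmaI)
  also have "\<dots> = (\<Sum>u\<in>R. \<Sum>v\<in>R - {u}. card R - 2)"
  proof (intro sum.cong refl)
    fix u v assume "u \<in> R" "v \<in> R - {u}"
    then show "card (R - {u, v}) = card R - 2" using card_Diff_subset[of "{u, v}" R] by auto
  qed
  also have "\<dots> = card R * ((card R - 1) * (card R - 2))"
    using assms by simp
  finally show ?thesis .
qed

text \<open>A linear lower bound, in the spirit of a tangent line, for the convex number of ordered triples. Summed
over all points it bounds the number of concurrent triples by the number of incidences alone.\<close>

lemma triple_count_tangent:
  fixes m :: real
  assumes "8 \<le> m"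
  shows "m\<^sup>2 / 16 * (real r - m / 2) \<le> real (r * ((r - 1) * (r - 2)))"
proof (cases "real r \<le> m / 2")
  case True
  then have "m\<^sup>2 / 16 * (real r - m / 2) \<le> 0" by (intro mult_nonneg_nonpos) auto
  then show ?thesis by (rule order_trans) simp
next
  case False
  then have r: "m / 2 \<le> real r" "4 \<le> r" using assms by linarith+
  have "m\<^sup>2 / 16 \<le> (real r / 2)\<^sup>2"
    using power_mono[of "m / 4" "real r / 2" 2] r assms by (simp add: power_divide)
  also have "\<dots> = (real r / 2) * (real r / 2)" by (simp add: power2_eq_square)
  also have "\<dots> \<le> (real r - 1) * (real r - 2)"
    using r(2) by (intro mult_mono) auto
  finally have *: "m\<^sup>2 / 16 \<le> (real r - 1) * (real r - 2)" .
  have "m\<^sup>2 / 16 * (real r - m / 2) \<le> m\<^sup>2 / 16 * real r"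
    using assms by (intro mult_left_mono) auto
  also have "\<dots> = real r * (m\<^sup>2 / 16)" by simp
  also have "\<dots> \<le> real r * ((real r - 1) * (real r - 2))"
    using * by (intro mult_left_mono) auto
  also have "\<dots> = real (r * ((r - 1) * (r - 2)))"
    using r(2) by (simp add: of_nat_diff)
  finally show ?thesis .
qed

text \<open>A line of the grid passes through a point of the \<open>X\<close> by \<open>2 * B\<close> integer grid for every integer abscissa
below \<open>X\<close>. So \<open>U\<close> has exactly \<open>card U * X\<close> incidences with that grid, a point lies on
\<open>m = card U / (2 * B)\<close> lines on average, and as soon as \<open>m\<close> is at least a constant, convexity
forces about \<open>m ^ 3\<close> triples per point. Already a subset of the grid of lines that is only a constant
times larger than one parallel class thus contains, for \<open>X\<close> of order \<open>B / A\<close> and up to a constant factor,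
as many concurrent triples as a random subset of its size.\<close>

lemma concurrent3_supersaturated:
  assumes U: "U \<subseteq> grid_lines A B" and AX: "A * X \<le> B" and big: "16 * B \<le> card U"
    and pos: "0 < A" "0 < X"
  shows "real X * real (card U) ^ 3 / (128 * real B ^ 2)
    \<le> real (card {(v, u, w). v \<in> U \<and> u \<in> U \<and> w \<in> U \<and> concurrent3 v u w})"
proof -
  have Bpos: "B > 0" using AX pos by (cases B) auto
  have finU: "finite U" using U finite_subset finite_grid_lines by blast
  define P where "P = {0..<int X} \<times> {0..<2 * int B}"
  define on where "on p l \<longleftrightarrow> snd p = fst l * fst p + snd l" for p l :: "int \<times> int"
  define R where "R p = {l \<in> U. on p l}" for p
  define T where "T p = {(u, v, w). u \<in> R p \<and> v \<in> R p \<and> w \<in> R p \<and> u \<noteq> v \<and> u \<noteq> w \<and> v \<noteq> w}" for p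
  define m where "m = real (card U) / (2 * real B)"
  have onI: "on_line (of_int (fst p), of_int (snd p)) l \<longleftrightarrow> on p l" for p l
  proof -
    have "on_line (of_int (fst p), of_int (snd p)) l \<longleftrightarrow>
        (of_int (snd p) :: real) = of_int (fst l * fst p + snd l)" by (simp add: on_line_def)
    then show ?thesis unfolding on_def of_int_eq_iff .
  qed
  have m8: "8 \<le> m" using big Bpos by (simp add: m_def field_simps)
  have finP: "finite P" and cardP: "real (card P) = real X * (2 * real B)" by (auto simp: P_def)
  have finR: "finite (R p)" for p using finU by (simp add: R_def)
  have inc: "(\<Sum>p\<in>P. card (R p)) = card U * X"
  proof -
    have "(\<Sum>p\<in>P. card {l \<in> U. on p l}) = (\<Sum>l\<in>U. X)"
    proof (rule sum_multicount_gen[OF finP finU], intro ballI)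
      fix l assume "l \<in> U"
      then obtain a b where l: "l = (a, b)" and ab: "0 \<le> a" "a < int A" "0 \<le> b" "b < int B"
        using U by (cases l) (auto simp: grid_lines_def)
      have "{p \<in> P. on p l} = (\<lambda>x. (x, a * x + b)) ` {0..<int X}"
      proof (intro equalityI subsetI)
        fix p assume "p \<in> (\<lambda>x. (x, a * x + b)) ` {0..<int X}"
        then obtain x where x: "p = (x, a * x + b)" "0 \<le> x" "x < int X" by auto
        have "a * x \<le> int A * int X" using ab x by (intro mult_mono) auto
        also have "\<dots> \<le> int B" using AX by (metis of_nat_le_iff of_nat_mult)
        finally show "p \<in> {p \<in> P. on p l}" using x ab by (auto simp: P_def on_def l)
      qed (auto simp: P_def on_def l)
      then show "card {p \<in> P. on p l} = X"
        by (simp add: card_image inj_on_def)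
    qed
    then show ?thesis by (simp add: R_def)
  qed
  have finT: "finite (T p)" for p
    by (rule finite_subset[of _ "R p \<times> R p \<times> R p"]) (auto simp: T_def finR)
  have disj: "T p \<inter> T q = {}" if "p \<noteq> q" for p q
  proof (rule ccontr)
    assume "T p \<inter> T q \<noteq> {}"
    then obtain u v where uv: "u \<noteq> v" "on p u" "on p v" "on q u" "on q v"
      by (auto simp: T_def R_def)
    then have "(of_int (fst p), of_int (snd p)) = ((of_int (fst q), of_int (snd q)) :: real \<times> real)"
      using on_line_unique_point[of "(of_int (fst p), of_int (snd p))" u v "(of_int (fst q), of_int (snd q))"]
      by (simp add: onI)
    then show False using that by (simp add: prod_eq_iff)
  qed
  have sub: "(\<Union>p\<in>P. T p) \<subseteq> {(v, u, w). v \<in> U \<and> u \<in> U \<and> w \<in> U \<and> concurrent3 v u w}" (is "_ \<subseteq> ?TT")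
  proof
    fix t assume "t \<in> (\<Union>p\<in>P. T p)"
    then obtain p where p: "t \<in> T p" by blast
    obtain v u w where t: "t = (v, u, w)" by (cases t)
    have h: "v \<in> R p" "u \<in> R p" "w \<in> R p" "v \<noteq> u" "v \<noteq> w" "u \<noteq> w"
      using p by (simp_all add: T_def t)
    have "concurrent {v, u, w}"
      unfolding concurrent_def
      by (rule exI[of _ "(of_int (fst p), of_int (snd p))"]) (use h in \<open>simp add: onI R_def\<close>)
    then show "t \<in> ?TT" using h by (simp add: t concurrent3_def R_def)
  qed
  have finTT: "finite ?TT" by (rule finite_subset[of _ "U \<times> U \<times> U"]) (auto simp: finU)
  have "real X * real (card U) ^ 3 / (128 * real B ^ 2) = m\<^sup>2 / 16 * (real (card U * X) - real (card P) * (m / 2))"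
    using Bpos by (simp add: m_def cardP field_simps power2_eq_square power3_eq_cube)
  also have "\<dots> = (\<Sum>p\<in>P. m\<^sup>2 / 16 * (real (card (R p)) - m / 2))"
    unfolding inc[symmetric]
    by (simp only: sum_distrib_left[symmetric] sum_subtractf of_nat_sum sum_constant)
  also have "\<dots> \<le> (\<Sum>p\<in>P. real (card (R p) * ((card (R p) - 1) * (card (R p) - 2))))"
    by (intro sum_mono triple_count_tangent m8)
  also have "\<dots> = real (\<Sum>p\<in>P. card (T p))"
    unfolding of_nat_sum T_def card_distinct_triples[OF finR] ..
  also have "\<dots> = real (card (\<Union>p\<in>P. T p))"
    using finP finT disj by (subst card_UN_disjoint) auto
  also have "\<dots> \<le> real (card ?TT)"
    using sub finTT by (intro of_nat_mono card_mono)
  finally show ?thesis .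
qed

section \<open>Concurrent quadruples in a grid of lines\<close>

lemma card_congruent_le:
  fixes c q :: int and B :: nat
  assumes q: "0 < q" "q \<le> int B"
  shows "real (card {b \<in> {0..<int B}. q dvd c - b}) \<le> 2 * real B / of_int q"
proof -
  let ?S = "{b \<in> {0..<int B}. q dvd c - b}"
  have "inj_on (\<lambda>b. b div q) ?S"
  proof (rule inj_onI)
    fix x y assume x: "x \<in> ?S" and y: "y \<in> ?S" and e: "x div q = y div q"
    have "x mod q = c mod q" "y mod q = c mod q" using x y by (simp_all add: mod_eq_dvd_iff[symmetric])
    with e show "x = y" by (metis div_mult_mod_eq)
  qed
  moreover have "(\<lambda>b. b div q) ` ?S \<subseteq> {0..int B div q}"
  proof
    fix y assume "y \<in> (\<lambda>b. b div q) ` ?S"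
    then obtain b where "y = b div q" "0 \<le> b" "b \<le> int B" by auto
    then show "y \<in> {0..int B div q}"
      using q zdiv_mono1[of b "int B" q] by (simp add: pos_imp_zdiv_nonneg_iff)
  qed
  ultimately have "card ?S \<le> card {0..int B div q}" by (rule card_inj_on_le) simp
  also have "\<dots> = nat (int B div q + 1)" by simp
  finally have "real (card ?S) \<le> of_int (int B div q) + 1"
    using q by (simp add: pos_imp_zdiv_nonneg_iff le_nat_iff)
  also have "of_int (int B div q) \<le> (real B / of_int q :: real)"
    using real_of_int_div4[of "int B" q] by simp
  also have "1 \<le> real B / of_int q" using q by (simp add: field_simps)
  finally show ?thesis by simp
qed

lemma sum_multiples_le:
  fixes h :: "nat \<Rightarrow> real"
  assumes "0 < k"
  shows "(\<Sum>x | x \<in> {1..A} \<and> k dvd x. h x) \<le> (\<Sum>i\<in>{1..A div k}. h (k * i))"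
proof -
  have "{x. x \<in> {1..A} \<and> k dvd x} = (\<lambda>i. k * i) ` {1..A div k}"
  proof (intro equalityI subsetI)
    fix x assume "x \<in> {x. x \<in> {1..A} \<and> k dvd x}"
    then obtain i where "x = k * i" "1 \<le> k * i" "k * i \<le> A" by (auto elim: dvdE)
    then show "x \<in> (\<lambda>i. k * i) ` {1..A div k}"
      using assms by (auto simp: less_eq_div_iff_mult_less_eq mult.commute Suc_le_eq)
  next
    fix x assume "x \<in> (\<lambda>i. k * i) ` {1..A div k}"
    then show "x \<in> {x. x \<in> {1..A} \<and> k dvd x}"
      using assms by (auto simp: less_eq_div_iff_mult_less_eq mult.commute Suc_le_eq)
  qed
  moreover have "inj_on (\<lambda>i. k * i) {1..A div k}" using assms by (auto simp: inj_on_def)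
  ultimately show ?thesis by (simp add: sum.reindex)
qed

text \<open>Bounding \<open>gcd d (gcd x y)\<close> by the sum of all common divisors \<open>k\<close> separates the three sums. The multiples of
\<open>k\<close> contribute \<open>A / k\<close> for each of \<open>x\<close> and \<open>y\<close> and \<open>harm A / k\<close> for \<open>d\<close>, so that
\<open>A ^ 2 * harm A\<close> times the sum of \<open>1 / k ^ 2\<close> remains; bounding the latter by \<open>harm A\<close> is good enough here.\<close>

lemma sum_gcd_quotient_le:
  "(\<Sum>d\<in>{1..A}. \<Sum>x\<in>{1..A}. \<Sum>y\<in>{1..A}. real (gcd d (gcd x y)) / real d) \<le> real A ^ 2 * harm A ^ 2"
proof -
  let ?I = "{1..A}"
  define i where "i k x = (if k dvd x then 1 else 0 :: real)" for k x :: nat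
  have cnt: "(\<Sum>x\<in>?I. i k x) \<le> real A / real k" if "k \<in> ?I" for k
  proof -
    have "(\<Sum>x\<in>?I. i k x) = (\<Sum>x | x \<in> ?I \<and> k dvd x. 1)"
      unfolding i_def by (simp add: sum.If_cases Int_def)
    also have "\<dots> \<le> (\<Sum>j\<in>{1..A div k}. 1)" by (rule sum_multiples_le) (use that in auto)
    also have "\<dots> \<le> real A / real k" using of_nat_div_le_of_nat[of A k, where 'a = real] by simp
    finally show ?thesis .
  qed
  have cnt': "(\<Sum>d\<in>?I. i k d / real d) \<le> harm A / real k" if "k \<in> ?I" for k
  proof -
    have "(\<Sum>d\<in>?I. i k d / real d) = (\<Sum>d\<in>?I. if k dvd d then 1 / real d else 0)"
      by (intro sum.cong) (auto simp: i_def)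
    also have "\<dots> = (\<Sum>d | d \<in> ?I \<and> k dvd d. 1 / real d)"
      by (simp add: sum.If_cases Int_def)
    also have "\<dots> \<le> (\<Sum>j\<in>{1..A div k}. 1 / real (k * j))" by (rule sum_multiples_le) (use that in auto)
    also have "\<dots> \<le> (\<Sum>j\<in>?I. 1 / real (k * j))" by (intro sum_mono2) (auto intro: order_trans[OF _ div_le_dividend])
    also have "\<dots> = harm A / real k" by (simp add: harm_def sum_divide_distrib divide_simps mult.commute)
    finally show ?thesis .
  qed
  have "(\<Sum>d\<in>?I. \<Sum>x\<in>?I. \<Sum>y\<in>?I. real (gcd d (gcd x y)) / real d)
      \<le> (\<Sum>d\<in>?I. \<Sum>x\<in>?I. \<Sum>y\<in>?I. \<Sum>k\<in>?I. real k * (i k d / real d) * i k x * i k y)"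
  proof (intro sum_mono)
    fix d x y assume d: "d \<in> ?I" "x \<in> ?I" "y \<in> ?I"
    let ?g = "gcd d (gcd x y)"
    have "?g \<le> d" by (rule gcd_le1_nat) (use d in auto)
    moreover have "d \<le> A" using d by simp
    ultimately have "?g \<le> A" by (rule order_trans)
    then have g: "?g \<in> ?I" using d by (simp add: Suc_le_eq)
    have "real ?g / real d = real ?g * (i ?g d / real d) * i ?g x * i ?g y"
      by (auto simp: i_def intro: dvd_trans)
    also have "\<dots> \<le> (\<Sum>k\<in>?I. real k * (i k d / real d) * i k x * i k y)"
      by (rule member_le_sum[OF g]) (auto simp: i_def)
    finally show "real ?g / real d \<le> (\<Sum>k\<in>?I. real k * (i k d / real d) * i k x * i k y)" .
  qed
  also have "\<dots> = (\<Sum>k\<in>?I. real k * (\<Sum>d\<in>?I. i k d / real d) * (\<Sum>x\<in>?I. i k x) * (\<Sum>y\<in>?I. i k y))"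
  proof -
    have "(\<Sum>d\<in>?I. \<Sum>x\<in>?I. \<Sum>y\<in>?I. \<Sum>k\<in>?I. real k * (i k d / real d) * i k x * i k y)
       = (\<Sum>d\<in>?I. \<Sum>x\<in>?I. \<Sum>k\<in>?I. \<Sum>y\<in>?I. real k * (i k d / real d) * i k x * i k y)"
      by (intro sum.cong refl sum.swap)
    also have "\<dots> = (\<Sum>d\<in>?I. \<Sum>k\<in>?I. \<Sum>x\<in>?I. \<Sum>y\<in>?I. real k * (i k d / real d) * i k x * i k y)"
      by (intro sum.cong refl sum.swap)
    also have "\<dots> = (\<Sum>k\<in>?I. \<Sum>d\<in>?I. \<Sum>x\<in>?I. \<Sum>y\<in>?I. real k * (i k d / real d) * i k x * i k y)"
      by (rule sum.swap)
    also have "\<dots> = (\<Sum>k\<in>?I. real k * (\<Sum>d\<in>?I. i k d / real d) * (\<Sum>x\<in>?I. i k x) * (\<Sum>y\<in>?I. i k y))"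
      by (simp only: sum_distrib_left[symmetric] sum_distrib_right[symmetric])
    finally show ?thesis .
  qed
  also have "\<dots> \<le> (\<Sum>k\<in>?I. real k * (harm A / real k) * (real A / real k) * (real A / real k))"
  proof (intro sum_mono)
    fix k assume k: "k \<in> ?I"
    have nn: "0 \<le> (\<Sum>x\<in>?I. i k x)" "0 \<le> (\<Sum>d\<in>?I. i k d / real d)"
      by (auto intro!: sum_nonneg simp: i_def)
    show "real k * (\<Sum>d\<in>?I. i k d / real d) * (\<Sum>x\<in>?I. i k x) * (\<Sum>y\<in>?I. i k y)
       \<le> real k * (harm A / real k) * (real A / real k) * (real A / real k)"
      using cnt[OF k] cnt'[OF k] nn by (intro mult_mono mult_nonneg_nonneg) auto
  qed
  also have "\<dots> = real A ^ 2 * harm A * (\<Sum>k\<in>?I. 1 / real k ^ 2)"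
    by (simp add: sum_distrib_left power2_eq_square field_simps)
  also have "\<dots> \<le> real A ^ 2 * harm A * harm A"
  proof (rule mult_left_mono)
    show "(\<Sum>k\<in>?I. 1 / real k ^ 2) \<le> harm A"
      unfolding harm_def
    proof (rule sum_mono)
      fix k assume "k \<in> ?I"
      then show "1 / real k ^ 2 \<le> inverse (real k)"
        by (simp add: divide_simps power2_eq_square)
    qed
    show "0 \<le> real A ^ 2 * harm A" using harm_nonneg[of A, where 'a = real] by simp
  qed
  finally show ?thesis by (simp add: power2_eq_square mult.assoc)
qed

lemma gcd3_mult_right_int: "gcd (d * c) (gcd (x * c) (y * c)) = gcd d (gcd x y) * \<bar>c\<bar>" for c d x y :: int
proof -
  have "gcd (x * c) (y * c) = gcd (x * \<bar>c\<bar>) (y * \<bar>c\<bar>)" by (metis abs_mult gcd_abs1_int gcd_abs2_int abs_idempotent)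
  moreover have "gcd (d * c) z = gcd (d * \<bar>c\<bar>) z" for z by (metis abs_mult gcd_abs1_int abs_idempotent)
  ultimately show ?thesis using gcd_mult_distrib_int[of "\<bar>c\<bar>"] by (simp add: mult.commute)
qed

text \<open>Let \<open>(a, b)\<close> be the line of least slope in a concurrent quadruple, and let \<open>a + d\<close>, \<open>a + x\<close>, \<open>a + y\<close> be
the other slopes. If \<open>b'\<close> is the intercept of the second line, the remaining two intercepts are
\<open>b - x * (b - b') / d\<close> and \<open>b - y * (b - b') / d\<close>. They are integers, so \<open>d\<close> divides
\<open>gcd d (gcd x y) * (b - b')\<close>, which leaves at most \<open>2 * B * gcd d (gcd x y) / d\<close> choices for \<open>b'\<close>. This
saves a factor of almost \<open>A\<close> over counting all choices of four slopes and two intercepts.\<close>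

lemma card_concurrent4_le:
  assumes AB: "A \<le> B"
  shows "real (card {q. q \<subseteq> grid_lines A B \<and> card q = 4 \<and> concurrent q})
     \<le> 2 * real A ^ 3 * real B ^ 2 * harm A ^ 2"
proof -
  let ?I = "{1..A}"
  let ?Q = "{q. q \<subseteq> grid_lines A B \<and> card q = 4 \<and> concurrent q}"
  define Bs where "Bs b d x y = {b' \<in> {0..<int B}. int d dvd int (gcd d (gcd x y)) * (b - b')}" for b d x y
  define T where "T = (SIGMA l:grid_lines A B. SIGMA d:?I. SIGMA x:?I. SIGMA y:?I. Bs (snd l) d x y)"
  define f :: "(int \<times> int) \<times> nat \<times> nat \<times> nat \<times> int \<Rightarrow> (int \<times> int) set" where
    "f = (\<lambda>((a, b), d, x, y, b'). {(a, b), (a + int d, b'),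
        (a + int x, b - (int x * (b - b')) div int d), (a + int y, b - (int y * (b - b')) div int d)})"
  have finBs: "finite (Bs b d x y)" for b d x y
    by (rule finite_subset[of _ "{0..<int B}"]) (auto simp: Bs_def)
  have finT: "finite T" by (simp add: T_def finBs)
  have "?Q \<subseteq> f ` T"
  proof
    fix q assume "q \<in> ?Q"
    then have q: "q \<subseteq> grid_lines A B" "card q = 4" "concurrent q" by auto
    then obtain X Y where XY: "\<And>l. l \<in> q \<Longrightarrow> on_line (X, Y) l" by (auto simp: concurrent_def)
    have finq: "finite q" using q(2) card.infinite by fastforce
    have "q \<noteq> {}" using q(2) by auto
    then have "Min (fst ` q) \<in> fst ` q" using finq by (intro Min_in) auto
    then obtain l where l: "l \<in> q" "fst l = Min (fst ` q)" by auto
    obtain a b where ab: "l = (a, b)" by (cases l)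
    have "card (q - {l}) = 3" using q(2) l(1) finq by simp
    then obtain l2 l3 l4 where r: "q - {l} = {l2, l3, l4}" by (auto simp: card_3_iff)
    have par: "\<exists>d b'. l' = (a + int d, b') \<and> d \<in> ?I \<and> b' \<in> {0..<int B} \<and> of_int (int d) * X = of_int (b - b')"
      if l': "l' \<in> q - {l}" for l'
    proof -
      obtain a' b' where ab': "l' = (a', b')" by (cases l')
      have "a' \<in> fst ` q" using l' ab' by (auto intro: image_eqI[of _ _ "(a', b')"])
      then have "a \<le> a'" using l(2) finq ab Min_le[of "fst ` q" a'] by simp
      moreover have "a \<noteq> a'"
        using on_line_same_slope[OF XY[OF l(1)] XY[of l']] l' ab ab' by auto
      moreover have "0 \<le> a" "a' < int A" "0 \<le> b'" "b' < int B"
        using q(1) l(1) l' ab ab' by (auto simp: grid_lines_def)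
      moreover have "of_int (a' - a) * X = of_int (b - b')"
        using XY[OF l(1)] XY[of l'] l' ab ab' by (auto simp: on_line_def algebra_simps)
      ultimately show ?thesis
        by (intro exI[of _ "nat (a' - a)"] exI[of _ b']) (auto simp: ab')
    qed
    obtain d b2 where d: "l2 = (a + int d, b2)" "d \<in> ?I" "b2 \<in> {0..<int B}" "of_int (int d) * X = of_int (b - b2)"
      using par[of l2] r by blast
    obtain x b3 where x: "l3 = (a + int x, b3)" "x \<in> ?I" "b3 \<in> {0..<int B}" "of_int (int x) * X = of_int (b - b3)"
      using par[of l3] r by blast
    obtain y b4 where y: "l4 = (a + int y, b4)" "y \<in> ?I" "b4 \<in> {0..<int B}" "of_int (int y) * X = of_int (b - b4)"
      using par[of l4] r by blast
    have ratio: "int z * (b - b2) = int d * (b - c)" if "of_int (int z) * X = of_int (b - c)" for z c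
    proof -
      have "(of_int (int z * (b - b2)) :: real) = of_int (int z) * (of_int (int d) * X)" using d(4) by simp
      also have "\<dots> = of_int (int d) * (of_int (int z) * X)" by simp
      also have "\<dots> = of_int (int d * (b - c))" using that by simp
      finally show ?thesis by (simp only: of_int_eq_iff)
    qed
    have "int d dvd gcd (int d * (b - b2)) (gcd (int x * (b - b2)) (int y * (b - b2)))"
      using ratio[OF x(4)] ratio[OF y(4)] by simp
    also have "\<dots> = int (gcd d (gcd x y)) * \<bar>b - b2\<bar>"
      by (simp add: gcd3_mult_right_int flip: gcd_int_int_eq)
    finally have "int d dvd int (gcd d (gcd x y)) * (b - b2)"
      by (rule dvd_trans) (simp add: mult_dvd_mono)
    then have "b2 \<in> Bs b d x y" using d(3) by (simp add: Bs_def)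
    moreover have "(int x * (b - b2)) div int d = b - b3" "(int y * (b - b2)) div int d = b - b4"
      using ratio[OF x(4)] ratio[OF y(4)] d(2) by simp_all
    ultimately have "((a, b), d, x, y, b2) \<in> T" "f ((a, b), d, x, y, b2) = {l, l2, l3, l4}"
      using d x y q(1) l(1) by (auto simp: T_def f_def ab)
    moreover have "q = {l, l2, l3, l4}" using r l(1) by blast
    ultimately show "q \<in> f ` T" by (metis imageI)
  qed
  then have "card ?Q \<le> card T" by (meson surj_card_le finT)
  also have "card T = (\<Sum>l\<in>grid_lines A B. \<Sum>d\<in>?I. \<Sum>x\<in>?I. \<Sum>y\<in>?I. card (Bs (snd l) d x y))"
    unfolding T_def by (simp add: card_SigmaI finBs)
  also have "real \<dots> \<le> (\<Sum>l\<in>grid_lines A B. \<Sum>d\<in>?I. \<Sum>x\<in>?I. \<Sum>y\<in>?I. 2 * real B * (real (gcd d (gcd x y)) / real d))"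
    unfolding of_nat_sum
  proof (intro sum_mono)
    fix l :: "int \<times> int" and d x y assume d: "d \<in> ?I" "x \<in> ?I" "y \<in> ?I"
    let ?g = "gcd d (gcd x y)"
    define q where "q = d div ?g"
    have dq: "d = ?g * q" by (simp add: q_def)
    have g0: "?g > 0" and q0: "q > 0" using d dq by (auto intro!: Nat.gr0I)
    have "q \<le> d" unfolding q_def by (rule div_le_dividend)
    then have qB: "q \<le> B" using d AB by auto
    have "Bs (snd l) d x y = {b' \<in> {0..<int B}. int q dvd snd l - b'}"
    proof -
      have "int d = int ?g * int q" using dq by (metis of_nat_mult)
      then have "int d dvd int ?g * z \<longleftrightarrow> int q dvd z" for z
        using g0 by auto
      then show ?thesis unfolding Bs_def by blast
    qed
    then have "real (card (Bs (snd l) d x y)) \<le> 2 * real B / of_int (int q)"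
      using card_congruent_le[of "int q" B "snd l"] q0 qB by simp
    also have "\<dots> = 2 * real B * (real ?g / real d)"
    proof -
      have "real d = real ?g * real q" using dq by (metis of_nat_mult)
      then show ?thesis using g0 q0 by simp
    qed
    finally show "real (card (Bs (snd l) d x y)) \<le> 2 * real B * (real ?g / real d)" .
  qed
  also have "\<dots> = real (A * B) * (2 * real B * (\<Sum>d\<in>?I. \<Sum>x\<in>?I. \<Sum>y\<in>?I. real (gcd d (gcd x y)) / real d))"
    by (simp only: sum_constant card_grid_lines sum_distrib_left[symmetric] of_nat_mult)
  also have "\<dots> \<le> real (A * B) * (2 * real B * (real A ^ 2 * harm A ^ 2))"
    by (intro mult_left_mono sum_gcd_quotient_le) auto
  also have "\<dots> = 2 * real A ^ 3 * real B ^ 2 * harm A ^ 2"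
    by (simp add: power2_eq_square power3_eq_cube)
  finally show ?thesis by simp
qed

section \<open>Random subsets with deletion\<close>

text \<open>In terms of probabilities: the chance that a random \<open>s\<close>-subset of an \<open>N\<close>-set contains \<open>j\<close> given points is at most \<open>(s / N) ^ j\<close>.\<close>

lemma binomial_shift_le:
  assumes "s \<le> N" "j \<le> s"
  shows "real (N - j choose (s - j)) * real N ^ j \<le> real (N choose s) * real s ^ j"
  using assms(2)
proof (induction j)
  case 0
  show ?case by simp
next
  case (Suc j)
  have "(s - j) * (N - j choose (s - j)) = (N - j) * (N - Suc j choose (s - Suc j))"
    using binomial_absorption[of "s - Suc j" "N - j"] Suc.prems
    by (simp add: Suc_diff_Suc)
  then have eq: "real (s - j) * real (N - j choose (s - j)) = real (N - j) * real (N - Suc j choose (s - Suc j))"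
    by (metis of_nat_mult)
  have sN: "real (s - j) * real N \<le> real (N - j) * real s"
  proof -
    have "real j * real s \<le> real j * real N" using assms(1) by (intro mult_left_mono) auto
    then show ?thesis using Suc.prems assms(1) by (simp add: of_nat_diff algebra_simps)
  qed
  have "real (N - j) * (real (N - Suc j choose (s - Suc j)) * real N ^ Suc j)
      = (real (s - j) * real N) * (real (N - j choose (s - j)) * real N ^ j)"
    using eq by (simp add: algebra_simps)
  also have "\<dots> \<le> (real (N - j) * real s) * (real (N choose s) * real s ^ j)"
    by (rule mult_mono[OF sN]) (use Suc in simp_all)
  finally have "real (N - j) * (real (N - Suc j choose (s - Suc j)) * real N ^ Suc j)
      \<le> real (N - j) * (real (N choose s) * real s ^ Suc j)" by (simp add: algebra_simps)
  then show ?case using Suc.prems assms(1) by (simp add: mult_le_cancel_left_pos)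
qed

lemma card_supersets_le:
  assumes fin: "finite \<Omega>" and N: "card \<Omega> = N" "0 < N" and s: "s \<le> N" and F: "F \<subseteq> \<Omega>"
  shows "real (card {R. R \<subseteq> \<Omega> \<and> card R = s \<and> F \<subseteq> R}) \<le> real (N choose s) * (real s / real N) ^ card F"
proof (cases "card F \<le> s")
  case False
  have "{R. R \<subseteq> \<Omega> \<and> card R = s \<and> F \<subseteq> R} = {}"
  proof (rule ccontr)
    assume "\<not> ?thesis"
    then obtain R where "R \<subseteq> \<Omega>" "card R = s" "F \<subseteq> R" by auto
    then show False using card_mono[of R F] finite_subset[of R \<Omega>] fin False by auto
  qed
  then show ?thesis by (simp only:) simp
next
  case True
  have finF: "finite F" using F fin finite_subset by blast
  let ?S = "{R'. R' \<subseteq> \<Omega> - F \<and> card R' = s - card F}"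
  have "{R. R \<subseteq> \<Omega> \<and> card R = s \<and> F \<subseteq> R} \<subseteq> (\<lambda>R'. R' \<union> F) ` ?S"
  proof
    fix R assume R: "R \<in> {R. R \<subseteq> \<Omega> \<and> card R = s \<and> F \<subseteq> R}"
    then have "R - F \<in> ?S" using finF by (auto simp: card_Diff_subset)
    moreover have "R = (R - F) \<union> F" using R by auto
    ultimately show "R \<in> (\<lambda>R'. R' \<union> F) ` ?S" by blast
  qed
  moreover have finS: "finite ?S" using fin by simp
  ultimately have "card {R. R \<subseteq> \<Omega> \<and> card R = s \<and> F \<subseteq> R} \<le> card ?S"
    by (meson surj_card_le)
  also have "\<dots> = (N - card F choose (s - card F))"
    using n_subsets[of "\<Omega> - F" "s - card F"] fin finF F N by (simp add: card_Diff_subset)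
  finally have "real (card {R. R \<subseteq> \<Omega> \<and> card R = s \<and> F \<subseteq> R}) * real N ^ card F
      \<le> real (N - card F choose (s - card F)) * real N ^ card F"
    by (intro mult_right_mono) auto
  also have "\<dots> \<le> real (N choose s) * real s ^ card F"
    by (rule binomial_shift_le[OF s True])
  finally show ?thesis using N by (simp add: power_divide field_simps)
qed

text \<open>The alteration method, with a uniformly random \<open>s\<close>-subset \<open>R\<close> of \<open>\<Omega>\<close>. By Markov's inequality \<open>R\<close>
contains more than \<open>s / 2\<close> members of \<open>Q\<close> with probability at most \<open>1 / 4\<close>, and by the union bound it
meets some member of \<open>\<C>\<close> in \<open>k\<close> points with probability at most \<open>1 / 2\<close>. In the remaining case
one deletes from \<open>R\<close> one point of each member of \<open>Q\<close> inside it. Probabilities appear as numbers of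
\<open>s\<close>-subsets, scaled by \<open>W\<close>, the number of all of them.\<close>

lemma sparse_sample:
  fixes \<Omega> :: "'a set"
  assumes fin: "finite \<Omega>" and N: "card \<Omega> = N" and s: "0 < s" "s \<le> N"
    and finC: "finite \<C>" and C: "\<And>C. C \<in> \<C> \<Longrightarrow> C \<subseteq> \<Omega> \<and> card C \<le> M"
    and Q: "\<And>q. q \<in> Q \<Longrightarrow> q \<subseteq> \<Omega> \<and> card q = r" and r: "0 < r"
    and fewQ: "real (card Q) * (real s / real N) ^ r \<le> real s / 8"
    and fewC: "real (card \<C>) * real (M choose k) * (real s / real N) ^ k \<le> 1 / 2"
  shows "\<exists>L \<subseteq> \<Omega>. real s / 2 \<le> real (card L) \<and> card L \<le> s \<and> (\<forall>q\<in>Q. \<not> q \<subseteq> L) \<and> (\<forall>C\<in>\<C>. card (L \<inter> C) < k)"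
proof -
  define S where "S = {R. R \<subseteq> \<Omega> \<and> card R = s}"
  define W where "W = real (N choose s)"
  have Npos: "0 < N" using s by simp
  have finS: "finite S" using fin by (simp add: S_def)
  have cardS: "real (card S) = W" using n_subsets[OF fin, of s] N by (simp add: S_def W_def)
  have Wpos: "W > 0" using s by (simp add: W_def)
  have finQ: "finite Q" by (rule finite_subset[of _ "Pow \<Omega>"]) (use Q fin in auto)
  have sup: "real (card {R \<in> S. F \<subseteq> R}) \<le> W * (real s / real N) ^ card F" if "F \<subseteq> \<Omega>" for F
    using card_supersets_le[OF fin N Npos s(2) that] by (simp add: S_def W_def conj_assoc)
  define c where "c R = card {q \<in> Q. q \<subseteq> R}" for R
  define Bad1 where "Bad1 = {R \<in> S. real s / 2 < real (c R)}"
  define Bad2 where "Bad2 = {R \<in> S. \<exists>C\<in>\<C>. k \<le> card (R \<inter> C)}"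
  have "real (card Bad1) * (real s / 2) \<le> W * (real s / 8)"
  proof -
    have "real (card Bad1) * (real s / 2) = (\<Sum>R\<in>Bad1. real s / 2)" by simp
    also have "\<dots> \<le> (\<Sum>R\<in>Bad1. real (c R))" by (intro sum_mono) (auto simp: Bad1_def)
    also have "\<dots> \<le> (\<Sum>R\<in>S. real (c R))" by (intro sum_mono2) (auto simp: Bad1_def finS)
    also have "\<dots> = real (\<Sum>R\<in>S. c R)" by simp
    also have "(\<Sum>R\<in>S. c R) = (\<Sum>q\<in>Q. card {R \<in> S. q \<subseteq> R})"
      unfolding c_def by (rule sum_multicount_gen[OF finS finQ]) simp
    also have "real \<dots> \<le> (\<Sum>q\<in>Q. W * (real s / real N) ^ r)"
      unfolding of_nat_sum using sup Q by (intro sum_mono) metis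
    also have "\<dots> = W * (real (card Q) * (real s / real N) ^ r)" by simp
    also have "\<dots> \<le> W * (real s / 8)" using fewQ Wpos by (intro mult_left_mono) auto
    finally show ?thesis .
  qed
  then have bad1: "real (card Bad1) \<le> W / 4" using s by (simp add: field_simps)
  have bad2: "real (card Bad2) \<le> W / 2"
  proof -
    let ?F = "\<lambda>C. {F. F \<subseteq> C \<and> card F = k}"
    have finCC: "finite C" if "C \<in> \<C>" for C using C[OF that] fin finite_subset by blast
    have "Bad2 \<subseteq> (\<Union>C\<in>\<C>. \<Union>F\<in>?F C. {R \<in> S. F \<subseteq> R})"
    proof
      fix R assume "R \<in> Bad2"
      then obtain C where R: "R \<in> S" "C \<in> \<C>" "k \<le> card (R \<inter> C)" by (auto simp: Bad2_def)
      then obtain F where "F \<subseteq> R \<inter> C" "card F = k"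
        using obtain_subset_with_card_n[OF R(3)] by metis
      then show "R \<in> (\<Union>C\<in>\<C>. \<Union>F\<in>?F C. {R \<in> S. F \<subseteq> R})" using R by blast
    qed
    then have "card Bad2 \<le> card (\<Union>C\<in>\<C>. \<Union>F\<in>?F C. {R \<in> S. F \<subseteq> R})"
      by (rule card_mono[rotated]) (rule finite_subset[OF _ finS], auto)
    also have "\<dots> \<le> (\<Sum>C\<in>\<C>. card (\<Union>F\<in>?F C. {R \<in> S. F \<subseteq> R}))"
      by (rule card_UN_le[OF finC])
    also have "real \<dots> \<le> (\<Sum>C\<in>\<C>. real (M choose k) * (W * (real s / real N) ^ k))"
      unfolding of_nat_sum
    proof (rule sum_mono)
      fix Cc assume Cc: "Cc \<in> \<C>"
      have "card (\<Union>F\<in>?F Cc. {R \<in> S. F \<subseteq> R}) \<le> (\<Sum>F\<in>?F Cc. card {R \<in> S. F \<subseteq> R})"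
        by (rule card_UN_le) (use finCC[OF Cc] in simp)
      also have "real \<dots> \<le> (\<Sum>F\<in>?F Cc. W * (real s / real N) ^ k)"
        unfolding of_nat_sum
      proof (rule sum_mono)
        fix F assume "F \<in> ?F Cc"
        then show "real (card {R \<in> S. F \<subseteq> R}) \<le> W * (real s / real N) ^ k"
          using sup[of F] C[OF Cc] by auto
      qed
      also have "\<dots> = real (card Cc choose k) * (W * (real s / real N) ^ k)"
        using n_subsets[OF finCC[OF Cc], of k] by simp
      also have "\<dots> \<le> real (M choose k) * (W * (real s / real N) ^ k)"
        using C[OF Cc] Wpos by (intro mult_right_mono of_nat_mono binomial_right_mono) auto
      finally show "real (card (\<Union>F\<in>?F Cc. {R \<in> S. F \<subseteq> R})) \<le> real (M choose k) * (W * (real s / real N) ^ k)"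
        by simp
    qed
    also have "\<dots> = W * (real (card \<C>) * real (M choose k) * (real s / real N) ^ k)" by simp
    also have "\<dots> \<le> W * (1 / 2)" using fewC Wpos by (intro mult_left_mono) auto
    finally show ?thesis by simp
  qed
  have "\<exists>R\<in>S. R \<notin> Bad1 \<union> Bad2"
  proof (rule ccontr)
    assume "\<not> ?thesis"
    then have "S \<subseteq> Bad1 \<union> Bad2" by blast
    then have "card S \<le> card (Bad1 \<union> Bad2)"
      by (rule card_mono[rotated]) (auto simp: Bad1_def Bad2_def finS)
    also have "\<dots> \<le> card Bad1 + card Bad2" by (rule card_Un_le)
    finally show False using bad1 bad2 cardS Wpos by linarith
  qed
  then obtain R where RS: "R \<in> S" and Rgood: "R \<notin> Bad1" "R \<notin> Bad2" by blast
  have R: "R \<subseteq> \<Omega>" "card R = s" "real (c R) \<le> real s / 2"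
    using RS Rgood(1) by (simp_all add: S_def Bad1_def not_less)
  have RC: "card (R \<inter> C) < k" if "C \<in> \<C>" for C
    using RS Rgood(2) that by (auto simp: Bad2_def not_le)
  have finR: "finite R" using R(1) fin finite_subset by blast
  define D where "D = (\<lambda>q. SOME x. x \<in> q) ` {q \<in> Q. q \<subseteq> R}"
  have D: "card D \<le> c R" unfolding D_def c_def by (rule card_image_le) (use finQ in simp)
  have "s \<le> card (R - D) + card D"
    using diff_card_le_card_Diff[of D R] finQ R(2) by (simp add: D_def)
  then have "real s / 2 \<le> real (card (R - D))" using D R(3) by linarith
  moreover have "card (R - D) \<le> s" using R(2) finR by (metis card_mono Diff_subset)
  moreover have "\<not> q \<subseteq> R - D" if q: "q \<in> Q" for q
  proof
    assume sub: "q \<subseteq> R - D"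
    have "q \<noteq> {}" using Q[OF q] r by auto
    then have "(SOME x. x \<in> q) \<in> q" by (simp add: some_in_eq)
    moreover have "(SOME x. x \<in> q) \<in> D" using q sub by (auto simp: D_def)
    ultimately show False using sub by blast
  qed
  moreover have "card ((R - D) \<inter> C) < k" if "C \<in> \<C>" for C
  proof -
    have "card ((R - D) \<inter> C) \<le> card (R \<inter> C)" using finR by (intro card_mono) auto
    then show ?thesis using RC[OF that] by linarith
  qed
  ultimately show ?thesis using R(1) by (intro exI[of _ "R - D"]) auto
qed

section \<open>A sparse set of grid lines with small independent subsets\<close>

text \<open>Let \<open>v\<close> be the size of \<open>V\<close>. Supersaturation provides about \<open>v ^ 3 / A ^ 8\<close> concurrent triples, whence the
choice of \<open>d\<close> of order \<open>v ^ 2 / A ^ 8\<close>. The cap \<open>v / A ^ 4\<close> is the one that balances the lengths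
\<open>v * cap / d\<close> and \<open>v / cap\<close> of the two rounds of branching: both have order \<open>A ^ 4\<close>, whatever \<open>v\<close> is.\<close>

lemma line_container_step:
  assumes A: "6 \<le> A" and V: "V \<subseteq> grid_lines A (A ^ 7)" and big: "64 * real A ^ 7 < real (card V)"
  shows "container_cover V (7 / 8 * real (card V)) ((A ^ 8 + 1) ^ (8196 * A ^ 4))
    {I. I \<subseteq> V \<and> indep3 concurrent3 I}"
proof -
  define a where "a = real A"
  define v where "v = real (card V)"
  have a6: "6 \<le> a" using A by (simp add: a_def)
  then have a0: "0 < a" by simp
  have v64: "64 * a ^ 7 < v" using big by (simp add: a_def v_def)
  have "0 < a ^ 7" using a0 by simp
  then have v0: "0 < v" using v64 by linarith
  have fin: "finite V" using V finite_subset finite_grid_lines by blast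
  have a1: "1 \<le> a ^ n" for n using a6 by (intro one_le_power) simp
  have v5: "2048 * a ^ 5 \<le> v"
  proof -
    have "6 ^ 2 \<le> a ^ 2" using a6 by (intro power_mono) auto
    then have "36 * a ^ 5 \<le> a ^ 2 * a ^ 5" using a0 by (intro mult_right_mono) auto
    also have "\<dots> = a ^ 7" by (simp add: power_add[symmetric])
    finally show ?thesis using v64 a1[of 5] by linarith
  qed
  have cap: "a \<le> v / a ^ 4"
  proof -
    have "a ^ 5 \<le> v" using v5 a1[of 5] by linarith
    then show ?thesis using a0 by (simp add: field_simps flip: power_Suc)
  qed
  have card_le: "card V \<le> A ^ 8"
  proof -
    have "card V \<le> card (grid_lines A (A ^ 7))" by (rule card_mono[OF _ V]) simp
    also have "\<dots> = A ^ 8" by (simp flip: power_Suc)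
    finally show ?thesis .
  qed
  have "container_cover V (7 / 8 * v) ((card V + 1) ^ (8193 * A ^ 4 + 3 * A ^ 4)) {I. I \<subseteq> V \<and> indep3 concurrent3 I}"
    unfolding v_def
  proof (rule container_step[where \<Delta> = a and cap = "v / a ^ 4" and \<delta> = "v / (2 * a ^ 4)" and d = "v ^ 2 / (4096 * a ^ 8)"])
    show "finite V" by (rule fin)
    show "V \<noteq> {}" using v0 by (auto simp: v_def)
    show "concurrent3 v w u" if "concurrent3 v u w" for u v w
      using that by (auto simp: concurrent3_def insert_commute)
    show "concurrent3 u v w" if "concurrent3 v u w" for u v w
      using that by (auto simp: concurrent3_def insert_commute)
    show "real (card {v \<in> V. concurrent3 v u w}) \<le> a" for u w
      using card_concurrent3_le[OF V] by (simp add: a_def)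
    show "0 < a" by (rule a0)
    show "a \<le> v / a ^ 4" by (rule cap)
    show "v / (2 * a ^ 4) \<le> v / a ^ 4 / 2" by simp
    \<comment> \<open>Each of the two summands is at most half of the guaranteed number of triples per vertex.\<close>
    show "(v ^ 2 / (4096 * a ^ 8) + a * (v / (2 * a ^ 4))) * real (card U)
        \<le> real (card {(v, u, w). v \<in> U \<and> u \<in> U \<and> w \<in> U \<and> concurrent3 v u w})"
      if U: "U \<subseteq> V" "real (card V) / 4 \<le> real (card U)" for U
    proof -
      let ?u = "real (card U)"
      have u: "v / 4 \<le> ?u" using U(2) by (simp add: v_def)
      have "16 * real A ^ 7 \<le> real (card U)" using U(2) big by simp
      then have "real (16 * A ^ 7) \<le> real (card U)" by simp
      then have "16 * A ^ 7 \<le> card U" by (simp only: of_nat_le_iff)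
      then have "real (A ^ 6) * ?u ^ 3 / (128 * real (A ^ 7) ^ 2)
          \<le> real (card {(v, u, w). v \<in> U \<and> u \<in> U \<and> w \<in> U \<and> concurrent3 v u w})"
        using U(1) V A by (intro concurrent3_supersaturated[of U A]) (auto simp flip: power_Suc)
      moreover have "real (A ^ 6) * ?u ^ 3 / (128 * real (A ^ 7) ^ 2) = ?u ^ 2 / (128 * a ^ 8) * ?u"
        using a0 by (simp add: a_def field_simps power2_eq_square power3_eq_cube flip: power_add)
      moreover have "(v ^ 2 / (4096 * a ^ 8) + a * (v / (2 * a ^ 4))) * ?u \<le> ?u ^ 2 / (128 * a ^ 8) * ?u"
      proof (rule mult_right_mono)
        have "(v / 4) ^ 2 \<le> ?u ^ 2" using u v0 by (intro power_mono) auto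
        then have "v ^ 2 / 16 / (128 * a ^ 8) \<le> ?u ^ 2 / (128 * a ^ 8)"
          using a0 by (intro divide_right_mono) (auto simp: power_divide)
        moreover have "a * (v / (2 * a ^ 4)) \<le> v ^ 2 / (4096 * a ^ 8)"
        proof -
          have "2048 * a ^ 5 * v \<le> v * v" using v5 v0 by (intro mult_right_mono) auto
          then have "2048 * a ^ 5 * v / (4096 * a ^ 8) \<le> v * v / (4096 * a ^ 8)"
            using a0 by (intro divide_right_mono) auto
          moreover have "a * (v / (2 * a ^ 4)) = 2048 * a ^ 5 * v / (4096 * a ^ 8)"
            using a0 by (simp add: field_simps power_eq_if)
          ultimately show ?thesis by (simp add: power2_eq_square)
        qed
        moreover have "v ^ 2 / 16 / (128 * a ^ 8) = v ^ 2 / (4096 * a ^ 8) + v ^ 2 / (4096 * a ^ 8)"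
          by simp
        ultimately show "v ^ 2 / (4096 * a ^ 8) + a * (v / (2 * a ^ 4)) \<le> ?u ^ 2 / (128 * a ^ 8)"
          by linarith
      qed simp
      ultimately show ?thesis by linarith
    qed
    show "real (card V) * (v / a ^ 4 + a) < real (8193 * A ^ 4) * (v ^ 2 / (4096 * a ^ 8))"
    proof -
      have "real (card V) * (v / a ^ 4 + a) \<le> v * (2 * (v / a ^ 4))"
        using cap v0 unfolding v_def[symmetric] by (intro mult_left_mono) linarith+
      also have "\<dots> = 8192 * (v ^ 2 / (4096 * a ^ 4))" by (simp add: power2_eq_square)
      also have "\<dots> < 8193 * (v ^ 2 / (4096 * a ^ 4))"
        by (rule mult_strict_right_mono) (use v0 a0 in simp_all)
      also have "\<dots> = real (8193 * A ^ 4) * (v ^ 2 / (4096 * a ^ 8))"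
        using a0 by (simp add: a_def field_simps flip: power_add)
      finally show ?thesis .
    qed
    show "real (card V) < real (3 * A ^ 4) * (v / (2 * a ^ 4))"
      using a0 v0 by (simp add: a_def v_def)
  qed
  then show ?thesis
    unfolding v_def
  proof (rule container_cover_mono)
    show "(card V + 1) ^ (8193 * A ^ 4 + 3 * A ^ 4) \<le> (A ^ 8 + 1) ^ (8196 * A ^ 4)"
      using card_le power_mono[of "card V + 1" "A ^ 8 + 1" "8196 * A ^ 4"] by simp
  qed simp
qed

text \<open>As \<open>7 / 8 \<le> exp (- 1 / 8)\<close>, about \<open>8 * ln A\<close> steps lead from all \<open>A ^ 8\<close> lines down to \<open>64 * A ^ 7\<close>.\<close>

lemma line_containers:
  assumes A: "6 \<le> A" and j: "8 * ln (real A) \<le> real j"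
  shows "container_cover (grid_lines A (A ^ 7)) (64 * real A ^ 7) ((A ^ 8 + 1) ^ (8196 * A ^ 4 * j))
    {I. I \<subseteq> grid_lines A (A ^ 7) \<and> indep3 concurrent3 I}"
proof -
  let ?\<Omega> = "grid_lines A (A ^ 7)"
  have A0: "0 < real A" using A by simp
  have "(7 / 8 :: real) ^ j \<le> exp (- (1 / 8)) ^ j"
    using exp_ge_add_one_self[of "- (1 / 8 :: real)"] by (intro power_mono) auto
  also have "\<dots> = exp (- (real j / 8))" by (simp add: exp_of_nat_mult[symmetric])
  also have "\<dots> \<le> exp (- ln (real A))" using j by simp
  also have "\<dots> = 1 / real A" using A0 by (simp add: exp_minus divide_inverse)
  finally have "(7 / 8) ^ j * real A ^ 8 \<le> 1 / real A * real A ^ 8" by (intro mult_right_mono) auto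
  also have "\<dots> = real A ^ 7" using A0 by (simp add: power_eq_if)
  also have "\<dots> \<le> 64 * real A ^ 7" by simp
  finally have "(7 / 8) ^ j * real (card ?\<Omega>) \<le> 64 * real A ^ 7" by (simp add: power_eq_if)
  then have "container_cover ?\<Omega> (64 * real A ^ 7) (((A ^ 8 + 1) ^ (8196 * A ^ 4)) ^ j)
      {I \<in> {I. indep3 concurrent3 I}. I \<subseteq> ?\<Omega>}"
  proof (rule container_cover_iterate[where \<Omega> = ?\<Omega>, rotated -1])
    fix V assume "V \<subseteq> ?\<Omega>" "64 * real A ^ 7 < real (card V)"
    from line_container_step[OF A this]
    show "container_cover V (7 / 8 * real (card V)) ((A ^ 8 + 1) ^ (8196 * A ^ 4))
      {I \<in> {I. indep3 concurrent3 I}. I \<subseteq> V}" by (simp add: conj_commute)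
  qed auto
  then show ?thesis by (simp add: power_mult conj_commute)
qed

text \<open>One term of the exponential series; it is used as the bound \<open>(k / e) ^ k \<le> k!\<close>.\<close>

lemma power_le_fact_exp: "real k ^ k \<le> fact k * exp (real k)"
proof -
  have "real k ^ k /\<^sub>R fact k \<le> (\<Sum>n. real k ^ n /\<^sub>R fact n)"
    using sum_le_suminf[OF summable_exp_generic[of "real k"], of "{k}"] by simp
  then show ?thesis by (simp add: exp_def field_simps)
qed

lemma harm_le_ln:
  assumes "0 < n"
  shows "harm n \<le> 1 + ln (real n)"
proof -
  from assms obtain m where m: "n = Suc m" by (cases n) auto
  have "harm (Suc m) - ln (real (Suc m)) \<le> harm (Suc 0) - ln (real (Suc 0))"
    by (rule decseqD[OF decseq_harm_diff_ln]) simp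
  then show ?thesis by (simp add: m harm_Suc harm_expand(1))
qed

text \<open>The number \<open>s\<close> of sampled lines is as large as the deletion of one line from each concurrent quadruple
permits: with probability \<open>s / A ^ 8\<close> per line, at most about \<open>A ^ 17 * (s / A ^ 8) ^ 4\<close> quadruples
survive, up to logarithms, and this stays below \<open>s\<close> for \<open>s\<close> up to about \<open>A ^ 5\<close>. A container of
\<open>64 * A ^ 7\<close> lines then keeps about \<open>A ^ 4\<close> of them on average, and there are only
\<open>exp (O (A ^ 4 * (1 + ln A) ^ 2))\<close> containers. So the union bound allows to ask that none of them keeps
more than a large constant times \<open>A ^ 4 * (1 + ln A) ^ 2\<close> lines.\<close>

lemma exists_line_set:
  assumes A: "6 \<le> A" and s: "0 < s" "real s \<le> real A ^ 5 / (4 * (1 + ln (real A)))"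
    and k: "600000 * real A ^ 4 * (1 + ln (real A)) ^ 2 \<le> real k"
  shows "\<exists>L \<subseteq> grid_lines A (A ^ 7). real s / 2 \<le> real (card L) \<and> card L \<le> s \<and>
    (\<forall>q. q \<subseteq> L \<and> card q = 4 \<longrightarrow> \<not> concurrent q) \<and>
    (\<forall>I. I \<subseteq> L \<and> indep3 concurrent3 I \<longrightarrow> card I < k)"
proof -
  let ?\<Omega> = "grid_lines A (A ^ 7)"
  define a where "a = real A"
  define h where "h = 1 + ln a"
  have a6: "6 \<le> a" using A by (simp add: a_def)
  then have a0: "0 < a" and lna: "0 \<le> ln a" and h1: "1 \<le> h" by (simp_all add: h_def)
  have a1: "1 \<le> a ^ n" for n using a6 by (intro one_le_power) simp
  have h2: "1 \<le> h ^ 2" using h1 by (rule one_le_power)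
  have s': "real s * (4 * h) \<le> a ^ 5" using s(2) h1 by (simp add: a_def h_def field_simps)
  have k': "600000 * a ^ 4 * h ^ 2 \<le> real k" using k by (simp add: a_def h_def)
  have s5: "real s \<le> a ^ 5"
  proof -
    have "real s * 1 \<le> real s * (4 * h)" using h1 by (intro mult_left_mono) auto
    then show ?thesis using s' by linarith
  qed
  have N: "card ?\<Omega> = A ^ 8" by (simp flip: power_Suc)
  define j where "j = nat \<lceil>8 * ln a\<rceil>"
  have j: "8 * ln a \<le> real j" "real j \<le> 8 * h"
  proof -
    have "0 \<le> \<lceil>8 * ln a\<rceil>" using lna by simp
    then have "real j = of_int \<lceil>8 * ln a\<rceil>" by (simp add: j_def)
    moreover have "8 * h = 8 * ln a + 8" by (simp add: h_def)
    ultimately show "8 * ln a \<le> real j" "real j \<le> 8 * h"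
      using le_of_int_ceiling[of "8 * ln a"] of_int_ceiling_le_add_one[of "8 * ln a"]
      by linarith+
  qed
  define M where "M = 64 * A ^ 7"
  obtain \<C> where C: "finite \<C>" "card \<C> \<le> (A ^ 8 + 1) ^ (8196 * A ^ 4 * j)"
    "\<forall>C\<in>\<C>. C \<subseteq> ?\<Omega> \<and> real (card C) \<le> 64 * real A ^ 7"
    "\<forall>I\<in>{I. I \<subseteq> ?\<Omega> \<and> indep3 concurrent3 I}. \<exists>C\<in>\<C>. I \<subseteq> C"
    using line_containers[OF A j(1)[unfolded a_def]] by (rule container_coverE)
  define Q where "Q = {q. q \<subseteq> ?\<Omega> \<and> card q = 4 \<and> concurrent q}"
  have "\<exists>L \<subseteq> ?\<Omega>. real s / 2 \<le> real (card L) \<and> card L \<le> s \<and> (\<forall>q\<in>Q. \<not> q \<subseteq> L) \<and> (\<forall>C\<in>\<C>. card (L \<inter> C) < k)"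
  proof (rule sparse_sample[OF _ N s(1) _ C(1), where M = M and r = 4])
    show "finite ?\<Omega>" by simp
    have "a ^ 5 \<le> a ^ 8" using a6 by (intro power_increasing) auto
    with s5 have "real s \<le> a ^ 8" by (rule order_trans)
    then have "real s \<le> real (A ^ 8)" by (simp only: a_def of_nat_power)
    then show "s \<le> A ^ 8" by (simp only: of_nat_le_iff)
    show "C \<subseteq> ?\<Omega> \<and> card C \<le> M" if "C \<in> \<C>" for C
    proof -
      have "real (card C) \<le> real M" using C(3) that by (auto simp: M_def)
      then show ?thesis using C(3) that by (simp only: of_nat_le_iff)
    qed
    show "q \<subseteq> ?\<Omega> \<and> card q = 4" if "q \<in> Q" for q using that by (simp add: Q_def)
    show "real (card Q) * (real s / real (A ^ 8)) ^ 4 \<le> real s / 8"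
    proof -
      have "real (card Q) \<le> 2 * real A ^ 3 * real (A ^ 7) ^ 2 * harm A ^ 2"
        unfolding Q_def using A by (intro card_concurrent4_le) (simp add: self_le_power)
      also have "\<dots> \<le> 2 * real A ^ 3 * real (A ^ 7) ^ 2 * h ^ 2"
        using harm_le_ln[of A] A harm_nonneg[of A, where 'a = real]
        by (intro mult_left_mono power_mono) (auto simp: h_def a_def)
      also have "\<dots> = 2 * a ^ 17 * h ^ 2" by (simp add: a_def flip: power_mult power_add)
      finally have "real (card Q) * (real s / real (A ^ 8)) ^ 4 \<le> 2 * a ^ 17 * h ^ 2 * (real s / a ^ 8) ^ 4"
        by (intro mult_mono) (auto simp: a_def)
      also have "\<dots> = 2 * real s * (real s ^ 3 * h ^ 2) / a ^ 15"
        using a0 by (simp add: field_simps power_eq_if)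
      also have "\<dots> \<le> 2 * real s * (a ^ 15 / 64) / a ^ 15"
      proof -
        have "(real s * (4 * h)) ^ 3 \<le> (a ^ 5) ^ 3" using s' h1 by (intro power_mono) auto
        then have "64 * (real s ^ 3 * h ^ 3) \<le> a ^ 15" by (simp add: power_mult_distrib flip: power_mult)
        moreover have "real s ^ 3 * h ^ 2 \<le> real s ^ 3 * h ^ 3"
          using h1 by (intro mult_left_mono power_increasing) auto
        ultimately have "real s ^ 3 * h ^ 2 \<le> a ^ 15 / 64" by linarith
        then show ?thesis using a0 by (intro divide_right_mono mult_left_mono) auto
      qed
      also have "\<dots> \<le> real s / 8" using a0 by simp
      finally show ?thesis .
    qed
    show "real (card \<C>) * real (M choose k) * (real s / real (A ^ 8)) ^ k \<le> 1 / 2"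
    proof -
      have kpos: "0 < real k"
      proof -
        have "0 < 600000 * a ^ 4 * h ^ 2" using a0 h1 by simp
        then show ?thesis using k' by linarith
      qed
      have "real (M choose k) * fact k \<le> real M ^ k"
        using binomial_fact_pow[of M k] by (metis of_nat_fact of_nat_le_iff of_nat_mult of_nat_power)
      then have *: "real (M choose k) * fact k * exp (real k) \<le> real M ^ k * exp (real k)"
        by (rule mult_right_mono) simp
      have "real (M choose k) * real k ^ k \<le> real (M choose k) * (fact k * exp (real k))"
        by (intro mult_left_mono power_le_fact_exp) simp
      also have "\<dots> = real (M choose k) * fact k * exp (real k)" by (simp only: mult.assoc)
      also note *
      finally have "real (M choose k) \<le> real M ^ k * exp (real k) / real k ^ k"
        using kpos by (simp add: pos_le_divide_eq)
      also have "\<dots> = (real M * exp 1 / real k) ^ k"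
        by (simp add: power_divide power_mult_distrib exp_of_nat_mult[symmetric])
      finally have "real (M choose k) \<le> (real M * exp 1 / real k) ^ k" .
      then have "real (M choose k) * (real s / real (A ^ 8)) ^ k \<le> (real M * exp 1 / real k) ^ k * (real s / real (A ^ 8)) ^ k"
        by (intro mult_right_mono) auto
      also have "\<dots> = (real M * exp 1 / real k * (real s / real (A ^ 8))) ^ k"
        by (rule power_mult_distrib[symmetric])
      also have "\<dots> \<le> exp (- 1) ^ k"
      proof (rule power_mono)
        have e: "exp 1 * exp 1 \<le> (9 :: real)"
          using mult_mono[OF exp_le exp_le] by simp
        have "real M * exp 1 * real s * exp 1 = 64 * a ^ 7 * real s * (exp 1 * exp 1)"
          by (simp add: M_def a_def)
        also have "\<dots> \<le> 64 * a ^ 7 * a ^ 5 * (exp 1 * exp 1)"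
          using s5 a0 by (intro mult_right_mono mult_left_mono) auto
        also have "\<dots> \<le> 64 * a ^ 7 * a ^ 5 * 9" using e a0 by (intro mult_left_mono) auto
        also have "\<dots> = 576 * a ^ 4 * a ^ 8" by (simp flip: power_add)
        also have "\<dots> \<le> real k * a ^ 8"
        proof (rule mult_right_mono)
          have "600000 * a ^ 4 * 1 \<le> 600000 * a ^ 4 * h ^ 2" using h2 a0 by (intro mult_left_mono) auto
          then show "576 * a ^ 4 \<le> real k" using k' a1[of 4] by linarith
        qed (use a0 in simp)
        finally have "real M * exp 1 * real s / (real k * a ^ 8) \<le> 1 / exp 1"
          using kpos a0 by (simp add: field_simps)
        then show "real M * exp 1 / real k * (real s / real (A ^ 8)) \<le> exp (- 1)"
          by (simp add: a_def exp_minus inverse_eq_divide)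
      qed (use kpos in simp)
      also have "\<dots> = exp (- real k)" by (simp add: exp_of_nat_mult[symmetric])
      finally have p: "real (M choose k) * (real s / real (A ^ 8)) ^ k \<le> exp (- real k)" .
      have c: "real (card \<C>) \<le> exp (590112 * a ^ 4 * h ^ 2)"
      proof -
        have "A ^ 8 + 1 \<le> A ^ 8 * 2" using A by (simp add: Suc_le_eq)
        also have "\<dots> \<le> A ^ 8 * A" using A by (intro mult_left_mono) auto
        finally have "A ^ 8 + 1 \<le> A ^ 9" by (simp add: power_eq_if mult.commute)
        then have "(A ^ 8 + 1) ^ (8196 * A ^ 4 * j) \<le> (A ^ 9) ^ (8196 * A ^ 4 * j)" by (intro power_mono) auto
        with C(2) have "card \<C> \<le> (A ^ 9) ^ (8196 * A ^ 4 * j)" by (rule order_trans)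
        then have "real (card \<C>) \<le> real ((A ^ 9) ^ (8196 * A ^ 4 * j))" by (simp only: of_nat_le_iff)
        also have "\<dots> = a ^ (9 * (8196 * A ^ 4 * j))" by (simp add: a_def power_mult)
        also have "\<dots> = exp (real (9 * (8196 * A ^ 4 * j)) * ln a)" using a0 by (simp only: exp_of_nat_mult exp_ln)
        also have "\<dots> \<le> exp (590112 * a ^ 4 * h ^ 2)"
        proof -
          have "real j * ln a \<le> (8 * h) * h" using j lna h1 by (intro mult_mono) (auto simp: h_def)
          then have "73764 * a ^ 4 * (real j * ln a) \<le> 73764 * a ^ 4 * ((8 * h) * h)"
            using a0 by (intro mult_left_mono) auto
          then show ?thesis by (simp add: a_def power2_eq_square mult_ac)
        qed
        finally show ?thesis .
      qed
      have "real (card \<C>) * (real (M choose k) * (real s / real (A ^ 8)) ^ k)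
          \<le> exp (590112 * a ^ 4 * h ^ 2) * exp (- real k)"
        using p c by (intro mult_mono) auto
      also have "\<dots> = exp (590112 * a ^ 4 * h ^ 2 - real k)" by (simp add: exp_add[symmetric])
      also have "\<dots> \<le> exp (- 1)"
      proof -
        have "1 * 1 \<le> a ^ 4 * h ^ 2" using a1[of 4] h2 by (intro mult_mono) auto
        then show ?thesis using k' by simp
      qed
      also have "\<dots> \<le> 1 / 2"
        using exp_ge_add_one_self[of "1 :: real"] by (simp add: exp_minus field_simps)
      finally show ?thesis by (simp add: mult.assoc)
    qed
  qed simp
  then obtain L where L: "L \<subseteq> ?\<Omega>" "real s / 2 \<le> real (card L)" "card L \<le> s"
    "\<forall>q\<in>Q. \<not> q \<subseteq> L" "\<forall>C\<in>\<C>. card (L \<inter> C) < k" by blast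
  have "\<not> concurrent q" if "q \<subseteq> L" "card q = 4" for q
    using that L(1,4) unfolding Q_def by blast
  moreover have "card I < k" if I: "I \<subseteq> L" "indep3 concurrent3 I" for I
  proof -
    obtain C where "C \<in> \<C>" "I \<subseteq> C" using C(4) I L(1) by blast
    moreover have "card I \<le> card (L \<inter> C)"
      using I(1) \<open>I \<subseteq> C\<close> L(1) by (intro card_mono) (auto intro: finite_subset)
    moreover have "card (L \<inter> C) < k" using L(5) \<open>C \<in> \<C>\<close> by blast
    ultimately show ?thesis by linarith
  qed
  ultimately show ?thesis using L(1-3) by blast
qed

section \<open>Lines in the Euclidean plane\<close>

definition plane_line :: "int \<times> int \<Rightarrow> (real ^ 2) set" where
  "plane_line l = {v. on_line (v $ 1, v $ 2) l}"

lemma is_line_plane_line: "is_line (plane_line l)"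
proof -
  define n :: "real ^ 2" where "n = vector [- of_int (fst l), 1]"
  have "n \<noteq> 0"
  proof
    assume "n = 0"
    then have "n $ 2 = 0" by simp
    then show False by (simp add: n_def)
  qed
  moreover have "plane_line l = {v. n \<bullet> v = of_int (snd l)}"
    by (auto simp: plane_line_def on_line_def n_def inner_vec_def sum_2)
  ultimately show ?thesis
    by (simp add: is_line_def affine_hyperplane aff_dim_hyperplane)
qed

lemma mem_plane_line: "vector [fst p, snd p] \<in> plane_line l \<longleftrightarrow> on_line p l"
  by (simp add: plane_line_def)

lemma inj_plane_line: "inj plane_line"
proof (rule injI)
  fix l l' assume e: "plane_line l = plane_line l'"
  have "on_line (x, of_int (fst l) * x + of_int (snd l)) l" for x by (simp add: on_line_def)
  then have "on_line (x, of_int (fst l) * x + of_int (snd l)) l'" for x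
    using e mem_plane_line by metis
  from this[of 0] this[of 1] show "l = l'" by (simp add: on_line_def prod_eq_iff)
qed

lemma concurrent_iff_Inter: "concurrent S \<longleftrightarrow> \<Inter>(plane_line ` S) \<noteq> {}"
proof
  assume "concurrent S"
  then obtain p where "\<forall>l\<in>S. on_line p l" by (auto simp: concurrent_def)
  then have "vector [fst p, snd p] \<in> \<Inter>(plane_line ` S)" by (simp add: mem_plane_line)
  then show "\<Inter>(plane_line ` S) \<noteq> {}" by blast
next
  assume "\<Inter>(plane_line ` S) \<noteq> {}"
  then obtain v where "\<forall>l\<in>S. v \<in> plane_line l" by auto
  then show "concurrent S" unfolding concurrent_def plane_line_def by blast
qed

theorem theorem2:
  fixes \<delta> :: real
  assumes "\<delta> > 0"
  shows "infinite {n :: nat. \<exists>L :: (real ^ 2) set set.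
           finite L \<and> card L = n \<and> (\<forall>l\<in>L. is_line l) \<and> k_independent 4 L \<and>
           (\<forall>L'. L' \<subseteq> L \<and> real (card L') \<ge> real n powr (4/5 + \<delta>) \<longrightarrow>
              (\<exists>l1\<in>L'. \<exists>l2\<in>L'. \<exists>l3\<in>L'. l1 \<noteq> l2 \<and> l1 \<noteq> l3 \<and> l2 \<noteq> l3 \<and>
                 l1 \<inter> l2 \<inter> l3 \<noteq> {}))}" (is "infinite ?S")
  unfolding infinite_nat_iff_unbounded_le
proof
  fix m :: nat
  \<comment> \<open>The sample size. As it has order \<open>A ^ 5 / ln A\<close>, its power \<open>4 / 5 + \<delta>\<close> outgrows \<open>A ^ 4 * (1 + ln A) ^ 2\<close>.\<close>
  define b where "b A = real A ^ 5 / (4 * (1 + ln (real A)))" for A :: nat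
  have "eventually (\<lambda>A. 600000 * real A ^ 4 * (1 + ln (real A)) ^ 2 + 1 \<le> ((b A - 1) / 2) powr (4 / 5 + \<delta>)) sequentially"
    unfolding b_def using assms by real_asymp
  moreover have "filterlim b at_top sequentially" unfolding b_def by real_asymp
  then have "eventually (\<lambda>A. 2 * real m + 2 \<le> b A) sequentially"
    by (simp add: filterlim_at_top)
  ultimately have "eventually (\<lambda>A. 6 \<le> A \<and> 2 * real m + 2 \<le> b A \<and>
      600000 * real A ^ 4 * (1 + ln (real A)) ^ 2 + 1 \<le> ((b A - 1) / 2) powr (4 / 5 + \<delta>)) sequentially"
    using eventually_ge_at_top[of 6] by eventually_elim simp
  then obtain A where A: "6 \<le> A" "2 * real m + 2 \<le> b A"
      "600000 * real A ^ 4 * (1 + ln (real A)) ^ 2 + 1 \<le> ((b A - 1) / 2) powr (4 / 5 + \<delta>)"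
    by (auto simp: eventually_sequentially)
  define s where "s = nat \<lfloor>b A\<rfloor>"
  define k where "k = nat \<lceil>600000 * real A ^ 4 * (1 + ln (real A)) ^ 2\<rceil>"
  have s: "real s \<le> b A" "b A - 1 \<le> real s" "2 * m + 1 \<le> s"
    using A(2) unfolding s_def by linarith+
  have "0 \<le> 600000 * real A ^ 4 * (1 + ln (real A)) ^ 2" by simp
  then have k: "600000 * real A ^ 4 * (1 + ln (real A)) ^ 2 \<le> real k"
      "real k \<le> 600000 * real A ^ 4 * (1 + ln (real A)) ^ 2 + 1"
    unfolding k_def by linarith+
  obtain L where L: "L \<subseteq> grid_lines A (A ^ 7)" "real s / 2 \<le> real (card L)" "card L \<le> s"
      "\<forall>q. q \<subseteq> L \<and> card q = 4 \<longrightarrow> \<not> concurrent q"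
      "\<forall>I. I \<subseteq> L \<and> indep3 concurrent3 I \<longrightarrow> card I < k"
    using exists_line_set[OF A(1) _ s(1)[unfolded b_def] k(1)] s(3) by auto
  have finL: "finite L" using L(1) finite_subset finite_grid_lines by blast
  have inj: "inj_on plane_line X" for X using inj_plane_line inj_on_subset by blast
  have k_le: "real k \<le> real (card L) powr (4 / 5 + \<delta>)"
  proof -
    have "real k \<le> ((b A - 1) / 2) powr (4 / 5 + \<delta>)" using k(2) A(3) by linarith
    also have "\<dots> \<le> real (card L) powr (4 / 5 + \<delta>)"
      using s(2) L(2) A(2) assms by (intro powr_mono2) auto
    finally show ?thesis .
  qed
  have "card L \<in> ?S"
  proof (intro CollectI exI[of _ "plane_line ` L"] conjI allI impI)
    show "finite (plane_line ` L)" using finL by simp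
    show "card (plane_line ` L) = card L" by (rule card_image[OF inj])
    show "\<forall>l\<in>plane_line ` L. is_line l" by (simp add: is_line_plane_line)
    show "k_independent 4 (plane_line ` L)"
      unfolding k_independent_def
    proof (intro allI impI)
      fix S assume S: "S \<subseteq> plane_line ` L \<and> card S = 4"
      then obtain q where q: "q \<subseteq> L" "S = plane_line ` q" by (auto simp: subset_image_iff)
      then have "card q = 4" using S card_image[OF inj[of q]] by simp
      then show "\<Inter>S = {}" using L(4) q concurrent_iff_Inter[of q] by blast
    qed
    fix L' assume L': "L' \<subseteq> plane_line ` L \<and> real (card L) powr (4 / 5 + \<delta>) \<le> real (card L')"
    then obtain I where I: "I \<subseteq> L" "L' = plane_line ` I" by (auto simp: subset_image_iff)
    then have "card I = card L'" using card_image[OF inj[of I]] by simp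
    then have "real k \<le> real (card I)" using k_le L' by linarith
    then have "\<not> card I < k" by simp
    then have "\<not> indep3 concurrent3 I" using L(5) I(1) by blast
    then obtain u v w where u: "u \<in> I" "v \<in> I" "w \<in> I" "concurrent3 u v w"
      by (auto simp: indep3_def)
    then have "plane_line u \<inter> plane_line v \<inter> plane_line w \<noteq> {}"
      using concurrent_iff_Inter[of "{u, v, w}"] by (auto simp: concurrent3_def)
    moreover have "plane_line u \<noteq> plane_line v" "plane_line u \<noteq> plane_line w" "plane_line v \<noteq> plane_line w"
      using u(4) by (simp_all add: concurrent3_def inj_eq[OF inj_plane_line])
    ultimately show "\<exists>l1\<in>L'. \<exists>l2\<in>L'. \<exists>l3\<in>L'. l1 \<noteq> l2 \<and> l1 \<noteq> l3 \<and> l2 \<noteq> l3 \<and> l1 \<inter> l2 \<inter> l3 \<noteq> {}"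
      using u(1-3) unfolding I(2) by blast
  qed
  moreover have "m \<le> card L" using L(2) s(3) by linarith
  ultimately show "\<exists>n\<ge>m. n \<in> ?S" by blast
qed

end
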